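(* Let $p$ be a prime, $p>3$, and let $t\in D_p$. If $t\not\equiv 0\pmod p$, then modulo $p$: \begin{align*} \sum_{k=0}^{\lfloor p/6\rfloor}S_k\bigl(t^2(4t+1)\bigr)^k&\equiv \frac{1+12t}{32t}\left(\frac{1+4t}{p}\right)-\frac{1-12t}{32t}\left(\frac{1-12t}{p}\right),\\ \sum_{k=0}^{p-1}S_k\bigl(t^2(4t+1)\bigr)^k&\equiv \frac{(1+12t)(1+4t)(1-6t)}{32t}\left(\frac{1+4t}{p}\right)-\frac{(1-12t)(24t^2+6t+1)}{32t}\left(\frac{1-12t}{p}\right). \end{align*} If $6t+1\not\equiv 0\pmod p$, then modulo $p$: \begin{align*} \sum_{k=0}^{\lfloor p/6\rfloor}(2k+1)S_k\bigl(t^2(4t+1)\bigr)^k&\equiv \frac{1+12t}{8(1+6t)}\left(\frac{1-12t}{p}\right)+\frac{3(1+4t)}{8(1+6t)}\left(\frac{1+4t}{p}\right),\\ \sum_{k=0}^{p-1}(2k+1)S_k\bigl(t^2(4t+1)\bigr)^k&\equiv \frac{(1+12t)(24t^2+6t+1)}{8(1+6t)}\left(\frac{1-12t}{p}\right)+\frac{3(1-6t)(1+4t)^2}{8(1+6t)}\left(\frac{1+4t}{p}\right). \end{align*}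
   Context: $S_n=\frac{\binom{6n}{3n}\binom{3n}{n}}{2\binom{2n}{n}(2n+1)}$ for $n\ge 0$. $D_p$ is the set of rationals whose denominator is not divisible by $p$; congruences are in the usual sense. For $c=a/b\in D_p$ in lowest terms, $\left(\frac{c}{p}\right)=\left(\frac{ab}{p}\right)$ (Legendre symbol), which is $0$ if $p\mid a$. *)

theory Defs
  imports "HOL-Number_Theory.Number_Theory"
begin

definition S :: "nat \<Rightarrow> rat" where
  "S n = of_nat (((6 * n) choose (3 * n)) * ((3 * n) choose n)) /
         of_nat (2 * ((2 * n) choose n) * (2 * n + 1))"

(* quotient_of returns the fraction in lowest terms, with positive denominator *)
definition D :: "nat \<Rightarrow> rat set" where
  "D p = {r. \<not> int p dvd snd (quotient_of r)}"

definition rat_cong :: "rat \<Rightarrow> rat \<Rightarrow> nat \<Rightarrow> bool" where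
  "rat_cong x y p \<longleftrightarrow> (\<exists>z\<in>D p. x - y = of_nat p * z)"

definition rat_Legendre :: "rat \<Rightarrow> nat \<Rightarrow> rat" where
  "rat_Legendre c p = (case quotient_of c of (a, b) \<Rightarrow> of_int (Legendre (a * b) (int p)))"

end

theory Submission
  imports Defs
begin

text \<open>
  Modulo \<open>p\<close>, the truncation at \<open>p div 6\<close> of \<open>\<Sum> S k * x ^ k = 2F1(1/6, 5/6; 3/2; 108 x) / 2\<close> is a
  terminating hypergeometric sum, because \<open>3 * (2 * n + 1) = p \<plusminus> 2\<close> for \<open>n = p div 6\<close>; such sums are,
  up to constants, Chebyshev polynomials \<open>sin ((2 n + 1) z) / sin z\<close> with \<open>sin z ^ 2 = 108 x\<close>. The substitution
  \<open>x = t ^ 2 * (4 * t + 1)\<close> trisects the angle: \<open>z = 3 w\<close> with \<open>2 * cos (2 w) = - 1 - 12 * t\<close>. Hence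
  everything is expressed through sines and cosines of \<open>(p \<plusminus> 2) w\<close>, and modulo \<open>p\<close> those of \<open>p w\<close> are
  given by \<open>(2 * sin w) ^ p\<close> and \<open>(2 * cos w) ^ p\<close>, which is where the Legendre symbols come from. The
  terms with \<open>p div 6 < k < (p - 1) / 2\<close> vanish, and those with \<open>k = (p - 1) / 2 + j\<close> form another
  terminating series, \<open>2F1(-1/3, 1/3; 1/2; 108 x)\<close>, which is a Chebyshev polynomial of the first kind.

  All trigonometric quantities are replaced by the Lucas sequence \<open>U (n + 2) = c * U (n + 1) - U n\<close>,
  whose terms are \<open>sin (2 n w) / sin (2 w)\<close> for \<open>c = 2 * cos (2 w)\<close>.
\<close>

section \<open>Lucas sequences\<close>

fun lucasU :: "'a::comm_ring_1 \<Rightarrow> nat \<Rightarrow> 'a" where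
  "lucasU c 0 = 0"
| "lucasU c (Suc 0) = 1"
| "lucasU c (Suc (Suc n)) = c * lucasU c (Suc n) - lucasU c n"

text \<open>Pascal's rule makes the odd and even binomial sums, \<open>?Q\<close> and
  \<open>?P\<close> below, feed each other in the same way as the values and the differences of the
  Lucas sequence. Hence both formulas go through one induction.\<close>

lemma lucasU_binomial_sums:
  fixes v :: "'a::comm_ring_1"
  shows "lucasU (v + 2) n = (\<Sum>k\<le>n. of_nat ((n + k) choose (2 * k + 1)) * v ^ k) \<and>
    lucasU (v + 2) (Suc n) - lucasU (v + 2) n = (\<Sum>k\<le>n. of_nat ((n + k) choose (2 * k)) * v ^ k)"
proof (induction n)
  case 0
  show ?case by simp
next
  case (Suc n)
  let ?P = "\<lambda>n. \<Sum>k\<le>n. of_nat ((n + k) choose (2 * k)) * v ^ k"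
  let ?Q = "\<lambda>n. \<Sum>k\<le>n. of_nat ((n + k) choose (2 * k + 1)) * v ^ k"
  have "?Q (Suc n) = (\<Sum>k\<le>Suc n. of_nat ((n + k) choose (2 * k + 1)) * v ^ k)
      + (\<Sum>k\<le>Suc n. of_nat ((n + k) choose (2 * k)) * v ^ k)"
    by (simp only: sum.distrib[symmetric]) (rule sum.cong, auto simp: algebra_simps)
  also have "\<dots> = ?Q n + ?P n" by (simp add: binomial_eq_0)
  finally have Q: "?Q (Suc n) = ?Q n + ?P n" .
  have "?P (Suc n) = 1 + (\<Sum>k\<le>n. of_nat ((Suc n + Suc k) choose (2 * Suc k)) * v ^ Suc k)"
    by (subst sum.atMost_Suc_shift) simp
  also have "\<dots> = (1 + (\<Sum>k\<le>n. of_nat ((n + Suc k) choose (2 * Suc k)) * v ^ Suc k))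
      + v * (\<Sum>k\<le>n. of_nat ((Suc n + k) choose (2 * k + 1)) * v ^ k)"
    by (simp add: sum_distrib_left sum.distrib[symmetric] algebra_simps)
  also have "1 + (\<Sum>k\<le>n. of_nat ((n + Suc k) choose (2 * Suc k)) * v ^ Suc k)
      = (\<Sum>k\<le>Suc n. of_nat ((n + k) choose (2 * k)) * v ^ k)"
    by (subst sum.atMost_Suc_shift) simp
  also have "\<dots> = ?P n" by (simp add: binomial_eq_0)
  also have "(\<Sum>k\<le>n. of_nat ((Suc n + k) choose (2 * k + 1)) * v ^ k) = ?Q (Suc n)"
    by (simp add: binomial_eq_0)
  finally have P: "?P (Suc n) = ?P n + v * ?Q (Suc n)" .
  have U: "lucasU (v + 2) (Suc n) = ?Q (Suc n)" unfolding Q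
    using Suc[THEN conjunct1] Suc[THEN conjunct2, THEN sym] by (simp del: of_nat_add)
  have "lucasU (v + 2) (Suc (Suc n)) - lucasU (v + 2) (Suc n)
      = (lucasU (v + 2) (Suc n) - lucasU (v + 2) n) + v * lucasU (v + 2) (Suc n)"
    by (simp add: algebra_simps)
  also have "\<dots> = ?P (Suc n)" unfolding P U[symmetric] using Suc[THEN conjunct2] by simp
  finally show ?case using U by simp
qed

lemmas lucasU_eq_sum = lucasU_binomial_sums[THEN conjunct1]
lemmas lucasU_diff_eq_sum = lucasU_binomial_sums[THEN conjunct2]

text \<open>For \<open>v + 2\<close> equal to 2 cos (2w), this sum of neighbours is sin ((2n + 1) w)
  / sin w; their difference is cos ((2n + 1) w) / cos w.\<close>

lemma lucasU_add_eq_sum: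
  fixes v :: "'a::comm_ring_1"
  shows "lucasU (v + 2) (Suc n) + lucasU (v + 2) n
    = (\<Sum>k\<le>n. of_nat (((n + k + 1) choose (2 * k + 1)) + ((n + k) choose (2 * k + 1))) * v ^ k)"
  unfolding lucasU_eq_sum by (simp add: binomial_eq_0 algebra_simps sum.distrib sum_distrib_left)

lemma lucasU_uminus: "lucasU (- c) n = (- 1) ^ Suc n * lucasU c n"
  by (induction c n rule: lucasU.induct) (auto simp: algebra_simps)

text \<open>The triple-angle formulas: \<open>C\<close> is 2 cos (6w) and
  \<open>c\<^sup>2 - 1\<close> is sin (6w) / sin (2w). The three residues of the index modulo 3 are
  carried together because each recurrence step uses two earlier terms.\<close>

lemma lucasU_triple_conj:
  fixes c :: "'a::comm_ring_1"
  defines "C \<equiv> c ^ 3 - 3 * c"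
  shows "lucasU c (3 * m) = (c\<^sup>2 - 1) * lucasU C m \<and>
    lucasU c (3 * m + 1) = lucasU C (Suc m) + c * lucasU C m \<and>
    lucasU c (3 * m + 2) = c * lucasU C (Suc m) + lucasU C m"
proof (induction m)
  case 0
  show ?case by (simp add: numeral_2_eq_2)
next
  case (Suc m)
  define a b where "a = lucasU C m" and "b = lucasU C (Suc m)"
  have step: "lucasU c (Suc (Suc k)) = c * lucasU c (Suc k) - lucasU c k" for k by simp
  have IH: "lucasU c (Suc (3 * m)) = b + c * a" "lucasU c (Suc (Suc (3 * m))) = c * b + a"
    using Suc by (simp_all add: a_def b_def del: lucasU.simps(3))
  have 3: "lucasU c (Suc (Suc (Suc (3 * m)))) = (c\<^sup>2 - 1) * b"
    unfolding step[of "Suc (3 * m)"] IH by (simp add: algebra_simps power2_eq_square)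
  have 4: "lucasU c (Suc (Suc (Suc (Suc (3 * m))))) = C * b - a + c * b"
    unfolding step[of "Suc (Suc (3 * m))"] 3 IH C_def
    by (simp add: algebra_simps power2_eq_square power3_eq_cube)
  have 5: "lucasU c (Suc (Suc (Suc (Suc (Suc (3 * m)))))) = c * (C * b - a) + b"
    unfolding step[of "Suc (Suc (Suc (3 * m)))"] 3 4
    by (simp add: algebra_simps power2_eq_square)
  have CC: "lucasU C (Suc (Suc m)) = C * b - a" by (simp add: a_def b_def)
  have idx: "3 * Suc m = Suc (Suc (Suc (3 * m)))" "k + 1 = Suc k" "k + 2 = Suc (Suc k)" for k by auto
  show ?case unfolding idx CC 3 4 5 by (simp add: b_def)
qed

lemmas lucasU_triple = lucasU_triple_conj[THEN conjunct1]
  lucasU_triple_conj[THEN conjunct2, THEN conjunct1]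
  lucasU_triple_conj[THEN conjunct2, THEN conjunct2]

text \<open>Doubling formulas, needed because the index \<open>3 * m\<close> of the upper range will
  be \<open>2 * h\<close> or \<open>2 * Suc h\<close>.\<close>

lemma lucasU_double:
  fixes c :: "'a::comm_ring_1"
  shows "lucasU c (2 * i) = 2 * lucasU c i * lucasU c (Suc i) - c * (lucasU c i)\<^sup>2 \<and>
    lucasU c (2 * i + 1) = (lucasU c (Suc i))\<^sup>2 - (lucasU c i)\<^sup>2"
proof (induction i)
  case 0
  show ?case by simp
next
  case (Suc i)
  define a b where "a = lucasU c i" and "b = lucasU c (Suc i)"
  have e: "lucasU c (2 * i) = 2 * a * b - c * a\<^sup>2" "lucasU c (Suc (2 * i)) = b\<^sup>2 - a\<^sup>2"
    using Suc by (simp_all add: a_def b_def)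
  have "lucasU c (Suc (Suc i)) = c * b - a" by (simp add: a_def b_def)
  moreover have "2 * Suc i = Suc (Suc (2 * i))" by simp
  ultimately show ?case
    by (simp add: e flip: b_def) (simp add: algebra_simps power2_eq_square)
qed

section \<open>Binomial coefficients\<close>

lemma binomial_odd_absorb:
  "(2 * of_nat k + 1) * of_nat ((n + k) choose (2 * k + 1))
    = (of_nat n - of_nat k :: rat) * of_nat ((n + k) choose (2 * k))"
proof -
  have "(2 * k + 1) * (((n + k) choose (2 * k)) + ((n + k) choose (2 * k + 1)))
      = (n + k + 1) * ((n + k) choose (2 * k))"
    using Suc_times_binomial_eq[of "n + k" "2 * k"] by (simp add: algebra_simps)
  from arg_cong[OF this, of "of_nat :: nat \<Rightarrow> rat"] show ?thesis
    by (simp add: algebra_simps)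
qed

text \<open>Used in two ways: for \<open>2 * n + 1\<close> equal to a prime it makes all but the
  last coefficient of \<open>lucasU_add_eq_sum\<close> divisible by that prime, and for
  \<open>n = p div 6\<close> it accounts for the denominator \<open>2 * k + 1\<close> of
  \<open>S k\<close>.\<close>

lemma binomial_odd_sum:
  "(2 * of_nat k + 1) * of_nat (((n + k + 1) choose (2 * k + 1)) + ((n + k) choose (2 * k + 1)))
    = (2 * of_nat n + 1 :: rat) * of_nat ((n + k) choose (2 * k))"
  using binomial_odd_absorb[of k n] by (simp add: algebra_simps)

text \<open>The term ratio of the terminating series 2F1(-n, n + 1; 1/2; -v/4).\<close>

lemma binomial_even_step:
  "(2 * of_nat k + 1) * (2 * of_nat k + 2) * of_nat ((n + Suc k) choose (2 * Suc k))
    = (of_nat n + of_nat k + 1) * (of_nat n - of_nat k :: rat) * of_nat ((n + k) choose (2 * k))"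
proof -
  have "(2 * k + 2) * ((n + Suc k) choose (2 * Suc k)) = (n + k + 1) * ((n + k) choose (2 * k + 1))"
    using Suc_times_binomial_eq[of "n + k" "2 * k + 1"] by simp
  from arg_cong[OF this, of "of_nat :: nat \<Rightarrow> rat"]
  have "(2 * of_nat k + 2 :: rat) * of_nat ((n + Suc k) choose (2 * Suc k))
      = (of_nat n + of_nat k + 1) * of_nat ((n + k) choose (2 * k + 1))"
    by (simp only: of_nat_mult of_nat_add of_nat_numeral of_nat_1)
  then have "(2 * of_nat k + 1) * (2 * of_nat k + 2) * of_nat ((n + Suc k) choose (2 * Suc k))
      = (of_nat n + of_nat k + 1) * ((2 * of_nat k + 1) * of_nat ((n + k) choose (2 * k + 1)) :: rat)"
    by (simp only: mult.assoc mult.left_commute)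
  then show ?thesis by (simp only: binomial_odd_absorb mult.assoc)
qed

text \<open>This is \<open>2 * m / (m + j) * ((m + j) choose (2 * j))\<close>, the coefficient of \<open>(-4 * sin z ^ 2) ^ j\<close> in \<open>2 * cos (2 m z)\<close>.\<close>

definition chebT_coeff :: "nat \<Rightarrow> nat \<Rightarrow> rat" where
  "chebT_coeff m j = of_nat ((m + j) choose (2 * j)) + of_nat ((m - 1 + j) choose (2 * j))"

lemma binomial_even_absorb:
  assumes "m > 0"
  shows "(of_nat m + of_nat j) * of_nat ((m - 1 + j) choose (2 * j))
    = (of_nat m - of_nat j :: rat) * of_nat ((m + j) choose (2 * j))"
proof (cases "j \<le> m")
  case True
  have "(m - j) * ((m + j) choose (2 * j)) = (m + j) * ((m - 1 + j) choose (2 * j))"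
    using binomial_absorb_comp[of "m + j" "2 * j"] assms True by simp
  from arg_cong[OF this, of "of_nat :: nat \<Rightarrow> rat"] True show ?thesis
    by (simp add: of_nat_diff)
next
  case False
  then show ?thesis by (simp add: binomial_eq_0)
qed

text \<open>The term ratio of the terminating series 2F1(-m, m; 1/2; -v/4).\<close>

lemma chebT_coeff_step:
  assumes "m > 0"
  shows "(2 * of_nat j + 1) * (2 * of_nat j + 2) * chebT_coeff m (Suc j)
    = (of_nat m ^ 2 - of_nat j ^ 2) * chebT_coeff m j"
proof -
  define X Y :: rat where "X = of_nat ((m + j) choose (2 * j))"
    and "Y = of_nat ((m - 1 + j) choose (2 * j))"
  have XY: "(of_nat m + of_nat j) * Y = (of_nat m - of_nat j) * X"
    unfolding X_def Y_def by (rule binomial_even_absorb[OF assms])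
  have m1: "of_nat (m - 1) = (of_nat m - 1 :: rat)" using assms by (simp add: of_nat_diff)
  have "(2 * of_nat j + 1) * (2 * of_nat j + 2) * chebT_coeff m (Suc j)
      = (of_nat m + of_nat j + 1) * (of_nat m - of_nat j) * X
        + (of_nat m + of_nat j) * (of_nat m - 1 - of_nat j) * Y"
    unfolding chebT_coeff_def X_def Y_def binomial_even_step m1
      distrib_left[of "(2 * of_nat j + 1) * (2 * of_nat j + 2 :: rat)"] by simp
  also have "\<dots> = (of_nat m ^ 2 - of_nat j ^ 2) * (X + Y)
      + ((of_nat m - of_nat j) * X - (of_nat m + of_nat j) * Y)"
    by (simp add: algebra_simps power2_eq_square)
  finally show ?thesis unfolding XY by (simp add: chebT_coeff_def X_def Y_def)
qed

text \<open>Coefficient form of the rule that the derivative of the Chebyshev polynomial T_m is m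
  U_(m-1).\<close>

lemma chebT_coeff_times_index:
  assumes "m > 0"
  shows "of_nat (Suc j) * chebT_coeff m (Suc j) = of_nat m * of_nat ((m + j) choose (2 * j + 1))"
proof -
  define X Y Z :: rat where "X = of_nat ((m + Suc j) choose (2 * Suc j))"
    and "Y = of_nat ((m - 1 + Suc j) choose (2 * Suc j))"
    and "Z = of_nat ((m + j) choose (2 * j + 1))"
  have XY: "(of_nat m + of_nat (Suc j)) * Y = (of_nat m - of_nat (Suc j)) * X"
    unfolding X_def Y_def by (rule binomial_even_absorb[OF assms])
  have "m - 1 + Suc j = m + j" using assms by simp
  then have XYZ: "X = Y + Z" unfolding X_def Y_def Z_def by simp
  show ?thesis using XY unfolding chebT_coeff_def X_def[symmetric] Y_def[symmetric] Z_def[symmetric]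
    by (simp add: XYZ algebra_simps)
qed

text \<open>Compare coefficients of y^k in (1 + y)^(p + a) and (1 + y^p) (1 + y)^a, which agree
  modulo p.\<close>

lemma binomial_add_prime_cong:
  assumes "prime p"
  shows "[(p + a) choose k = (a choose k) + (if p \<le> k then a choose (k - p) else 0)] (mod p)"
proof (induction a arbitrary: k)
  case 0
  consider "k = 0" | "0 < k" "k < p" | "k = p" | "k > p" by linarith
  then show ?case
  proof cases
    case 2
    then show ?thesis using dvd_choose_prime[of k p] assms by (simp add: cong_0_iff binomial_eq_0)
  qed (use prime_gt_0_nat[OF assms] in \<open>auto simp: binomial_eq_0\<close>)
next
  case (Suc a)
  show ?case
  proof (cases k)
    case 0
    then show ?thesis using prime_gt_0_nat[OF assms] by simp
  next
    case (Suc k')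
    have "[((p + a) choose k') + ((p + a) choose Suc k')
        = ((a choose k') + (if p \<le> k' then a choose (k' - p) else 0))
          + ((a choose Suc k') + (if p \<le> Suc k' then a choose (Suc k' - p) else 0))] (mod p)"
      by (intro cong_add Suc.IH)
    also have "((a choose k') + (if p \<le> k' then a choose (k' - p) else 0))
          + ((a choose Suc k') + (if p \<le> Suc k' then a choose (Suc k' - p) else 0))
        = (Suc a choose k) + (if p \<le> k then Suc a choose (k - p) else 0)"
    proof -
      \<comment> \<open>In the boundary case \<open>p = Suc k'\<close> only one of the two Pascal
        summands has its shifted term, which is \<open>a choose 0\<close>.\<close>
      consider "p \<le> k'" | "p = Suc k'" | "p > Suc k'" by linarith
      then show ?thesis using Suc by cases (auto simp: Suc_diff_le)
    qed
    finally show ?thesis using Suc by simp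
  qed
qed

section \<open>The coefficients \<open>S\<close> and their term ratio\<close>

lemma S_eq_fact:
  "S n = fact (6 * n) * fact n / (2 * (2 * of_nat n + 1) * fact (3 * n) * (fact (2 * n))\<^sup>2)"
proof -
  have binomials: "of_nat ((6 * n) choose (3 * n)) = (fact (6 * n) / (fact (3 * n) * fact (3 * n)) :: rat)"
    "of_nat ((3 * n) choose n) = (fact (3 * n) / (fact n * fact (2 * n)) :: rat)"
    "of_nat ((2 * n) choose n) = (fact (2 * n) / (fact n * fact n) :: rat)"
    using binomial_fact[of "3 * n" "6 * n"] binomial_fact[of n "3 * n"] binomial_fact[of n "2 * n"]
    by simp_all
  define M where "M = 2 * of_nat n + (1 :: rat)"
  have "S n = of_nat ((6 * n) choose (3 * n)) * of_nat ((3 * n) choose n)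
      / (2 * of_nat ((2 * n) choose n) * M)"
    by (simp add: S_def M_def algebra_simps)
  moreover have "M \<noteq> 0" unfolding M_def by (simp add: add_nonneg_pos less_imp_neq[symmetric])
  ultimately show ?thesis
    unfolding binomials M_def[symmetric] by (simp add: field_simps power2_eq_square)
qed

text \<open>The ratio 108 (k + 1/6) (k + 5/6) / ((k + 1) (k + 3/2)) of the hypergeometric series,
  cleared of denominators.\<close>

lemma S_step:
  "of_nat (k + 1) * of_nat (2 * k + 3) * S (Suc k) = of_nat (6 * (6 * k + 1) * (6 * k + 5)) * S k"
proof -
  define K :: rat where "K = of_nat k"
  have K: "K \<ge> 0" by (simp add: K_def)
  define a b c d :: rat where "a = fact (6 * k)" and "b = fact (3 * k)"
    and "c = fact (2 * k)" and "d = fact k"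
  have bc: "b \<noteq> 0" "c \<noteq> 0" by (simp_all add: b_def c_def)
  have "fact (6 * Suc k) = (6*K+6)*(6*K+5)*(6*K+4)*(6*K+3)*(6*K+2)*(6*K+1) * a"
    "fact (3 * Suc k) = (3*K+3)*(3*K+2)*(3*K+1) * b"
    "fact (2 * Suc k) = (2*K+2)*(2*K+1) * c" "fact (Suc k) = (K+1) * d"
    by (simp_all add: K_def a_def b_def c_def d_def numeral_eq_Suc algebra_simps)
  note facts = this
  have K1: "2 * of_nat (Suc k) + 1 = 2*K+3" by (simp add: K_def)
  have S1: "S (Suc k) = (6*K+6)*(6*K+5)*(6*K+4)*(6*K+3)*(6*K+2)*(6*K+1) * a * ((K+1)*d)
      / (2 * (2*K+3) * ((3*K+3)*(3*K+2)*(3*K+1)*b) * ((2*K+2)*(2*K+1) * c)\<^sup>2)"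
    unfolding S_eq_fact facts K1 ..
  have S0: "S k = a * d / (2 * (2 * K + 1) * b * c\<^sup>2)"
    unfolding S_eq_fact K_def a_def b_def c_def d_def ..
  have nz: "K + 1 \<noteq> 0" "2*K+1 \<noteq> 0" "2*K+3 \<noteq> 0" "3*K+1 \<noteq> 0" "3*K+2 \<noteq> 0" using K by auto
  \<comment> \<open>With the linear factors as atoms, the common ones cancel without multiplying
    out.\<close>
  define A B E F G H where "A = K + 1" and "B = 2*K+1" and "E = 2*K+3" and "F = 3*K+1" and "G = 3*K+2" and "H = 6*K+1"
  note factors = this
  have fac: "6*K+6 = 6*A" "3*K+3 = 3*A" "2*K+2 = 2*A" "6*K+3 = 3*B"
    "6*K+4 = 2*G" "6*K+2 = 2*F"
    by (simp_all add: factors)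
  have "(K + 1) * (2*K+3) * S (Suc k) = 6*(6*K+1)*(6*K+5) * S k"
    using nz bc unfolding S1 S0 fac factors[symmetric]
    by (simp add: divide_simps power2_eq_square)
  then show ?thesis by (simp add: K_def add.commute)
qed

section \<open>Congruences between p-integral rationals\<close>

text \<open>Dropping the demand for lowest terms lets closure under the ring operations be checked
  on any representing fractions.\<close>

lemma D_iff_fraction:
  assumes "prime p"
  shows "r \<in> D p \<longleftrightarrow> (\<exists>a b. \<not> int p dvd b \<and> r = of_int a / of_int b)"
proof
  assume "r \<in> D p"
  then show "\<exists>a b. \<not> int p dvd b \<and> r = of_int a / of_int b"
    unfolding D_def by (metis (mono_tags) mem_Collect_eq prod.collapse quotient_of_div)
next
  assume "\<exists>a b. \<not> int p dvd b \<and> r = of_int a / of_int b"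
  then obtain a b where ab: "\<not> int p dvd b" "r = of_int a / of_int b" by blast
  obtain c d where q: "quotient_of r = (c, d)" by (cases "quotient_of r")
  have cd: "coprime c d" "r = of_int c / of_int d" "d > 0"
    using q quotient_of_coprime quotient_of_div quotient_of_denom_pos by auto
  have "b \<noteq> 0" using ab(1) by auto
  then have "(of_int (c * b) :: rat) = of_int (a * d)"
    using ab(2) cd by (simp add: field_simps)
  then have eq: "c * b = a * d" by (simp only: of_int_eq_iff)
  have "\<not> int p dvd d"
  proof
    assume "int p dvd d"
    then have "int p dvd c * b" by (simp add: eq)
    then have "int p dvd c" using ab(1) assms prime_dvd_multD[of "int p"] by auto
    with \<open>int p dvd d\<close> cd(1) have "int p dvd 1" using coprime_common_divisor by blast
    then show False using assms by auto
  qed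
  then show "r \<in> D p" by (simp add: D_def q)
qed

locale prime_localization =
  fixes p :: nat
  assumes prime_p: "prime p" and p_gt_3: "p > 3"
begin

definition congp :: "rat \<Rightarrow> rat \<Rightarrow> bool" (infix "\<approx>" 50)
  where "x \<approx> y \<longleftrightarrow> rat_cong x y p"

lemma D_of_int [simp, intro]: "of_int a \<in> D p"
  using prime_p by (auto simp: D_def)

lemma D_of_nat [simp, intro]: "of_nat a \<in> D p"
  using D_of_int[of "int a"] by simp

lemma D_numeral [simp, intro]: "numeral a \<in> D p" "0 \<in> D p" "1 \<in> D p"
  using D_of_nat[of "numeral a"] D_of_nat[of 0] D_of_nat[of 1] by simp_all

lemma D_mult [simp, intro]:
  assumes "x \<in> D p" "y \<in> D p" shows "x * y \<in> D p"
proof -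
  obtain a b a' b' where *: "\<not> int p dvd b" "x = of_int a / of_int b"
      "\<not> int p dvd b'" "y = of_int a' / of_int b'"
    using assms by (auto simp: D_iff_fraction[OF prime_p])
  then have "\<not> int p dvd b * b'" using prime_p by (simp add: prime_dvd_mult_iff)
  moreover have "x * y = of_int (a * a') / of_int (b * b')" using * by simp
  ultimately show ?thesis unfolding D_iff_fraction[OF prime_p] by blast
qed

lemma D_add [simp, intro]:
  assumes "x \<in> D p" "y \<in> D p" shows "x + y \<in> D p"
proof -
  obtain a b a' b' where *: "\<not> int p dvd b" "x = of_int a / of_int b"
      "\<not> int p dvd b'" "y = of_int a' / of_int b'"
    using assms by (auto simp: D_iff_fraction[OF prime_p])
  then have nz: "b \<noteq> 0" "b' \<noteq> 0" by auto
  have "\<not> int p dvd b * b'" using * prime_p by (simp add: prime_dvd_mult_iff)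
  moreover have "x + y = of_int (a * b' + a' * b) / of_int (b * b')" 
    using * nz by (simp add: field_simps)
  ultimately show ?thesis unfolding D_iff_fraction[OF prime_p] by blast
qed

lemma D_uminus [simp, intro]: "x \<in> D p \<Longrightarrow> - x \<in> D p"
  using D_mult[OF D_of_int[of "-1"], of x] by simp

lemma D_diff [simp, intro]: "x \<in> D p \<Longrightarrow> y \<in> D p \<Longrightarrow> x - y \<in> D p"
  using D_add[of x "- y"] by simp

lemma D_power [simp, intro]: "x \<in> D p \<Longrightarrow> x ^ k \<in> D p"
  by (induction k) auto

lemma congpI: "x - y = of_nat p * z \<Longrightarrow> z \<in> D p \<Longrightarrow> x \<approx> y"
  unfolding congp_def rat_cong_def by blast

lemma congpE:
  assumes "x \<approx> y" obtains z where "z \<in> D p" "x - y = of_nat p * z"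
  using assms unfolding congp_def rat_cong_def by blast

lemma congp_refl [simp, intro]: "x \<approx> x"
  by (rule congpI[of _ _ 0]) auto

lemma congp_sym: "x \<approx> y \<Longrightarrow> y \<approx> x"
proof (erule congpE)
  fix z assume "z \<in> D p" "x - y = of_nat p * z"
  then show "y \<approx> x" by (intro congpI[of _ _ "- z"]) (auto simp: algebra_simps)
qed

lemma congp_add: "x \<approx> y \<Longrightarrow> x' \<approx> y' \<Longrightarrow> x + x' \<approx> y + y'"
proof (elim congpE)
  fix z z' assume "z \<in> D p" "x - y = of_nat p * z" "z' \<in> D p" "x' - y' = of_nat p * z'"
  then show "x + x' \<approx> y + y'" by (intro congpI[of _ _ "z + z'"]) (auto simp: algebra_simps)
qed

lemma congp_trans [trans]: "x \<approx> y \<Longrightarrow> y \<approx> z \<Longrightarrow> x \<approx> z"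
  using congp_add[of x y y z] by (auto simp: congp_def rat_cong_def)

lemma congp_lmult: "d \<in> D p \<Longrightarrow> x \<approx> y \<Longrightarrow> d * x \<approx> d * y"
proof (elim congpE)
  fix z assume "d \<in> D p" "z \<in> D p" "x - y = of_nat p * z"
  then show "d * x \<approx> d * y"
    by (intro congpI[of _ _ "d * z"]) (auto simp: algebra_simps simp flip: right_diff_distrib)
qed

lemma congp_diff: "x \<approx> y \<Longrightarrow> x' \<approx> y' \<Longrightarrow> x - x' \<approx> y - y'"
  using congp_add[of x y "- x'" "- y'"] congp_lmult[of "-1" x' y'] by auto

lemma congp_D: "x \<approx> y \<Longrightarrow> y \<in> D p \<Longrightarrow> x \<in> D p"
proof (elim congpE)
  fix z assume "y \<in> D p" "z \<in> D p" "x - y = of_nat p * z"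
  then have "x = y + of_nat p * z" by simp
  with \<open>y \<in> D p\<close> \<open>z \<in> D p\<close> show "x \<in> D p" by auto
qed

text \<open>Congruence alone does not make either side p-integral, so integrality of one side of
  each congruence is assumed; \<open>congp_D\<close> transfers it to the other.\<close>

lemma congp_mult:
  assumes "x \<approx> y" "x' \<approx> y'" "y \<in> D p" "y' \<in> D p" shows "x * x' \<approx> y * y'"
proof -
  have "x \<in> D p" using assms congp_D by blast
  then have "x * x' \<approx> x * y'" using assms congp_lmult by blast
  also have "x * y' \<approx> y * y'" using congp_lmult[of y' x y] assms by (simp add: mult.commute)
  finally show ?thesis .
qed

lemma congp_power: "x \<approx> y \<Longrightarrow> y \<in> D p \<Longrightarrow> x ^ k \<approx> y ^ k"
  by (induction k) (auto intro: congp_mult)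

lemma congp_sum: "(\<And>k. k \<in> I \<Longrightarrow> f k \<approx> g k) \<Longrightarrow> sum f I \<approx> sum g I"
  by (induction I rule: infinite_finite_induct) (auto intro: congp_add)

lemma congp_of_int_iff: "of_int a \<approx> of_int b \<longleftrightarrow> [a = b] (mod int p)"
proof
  assume "of_int a \<approx> of_int b"
  then obtain z where z: "z \<in> D p" "(of_int a :: rat) - of_int b = of_nat p * z" by (rule congpE)
  then obtain c d where cd: "\<not> int p dvd d" "z = of_int c / of_int d"
    by (auto simp: D_iff_fraction[OF prime_p])
  then have "d \<noteq> 0" by auto
  with z cd have "(of_int ((a - b) * d) :: rat) = of_int (int p * c)" by (simp add: field_simps)
  then have "(a - b) * d = int p * c" by (simp only: of_int_eq_iff)
  then have "int p dvd (a - b) * d" by simp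
  then have "int p dvd a - b" using cd prime_p by (simp add: prime_dvd_mult_iff)
  then show "[a = b] (mod int p)" by (simp add: cong_iff_dvd_diff)
next
  assume "[a = b] (mod int p)"
  then obtain k where "a - b = int p * k" by (auto simp: cong_iff_dvd_diff)
  then have "(of_int (a - b) :: rat) = of_int (int p * k)" by simp
  then show "of_int a \<approx> of_int b" by (intro congpI[of _ _ "of_int k"]) auto
qed

lemma congp_of_nat_iff: "of_nat a \<approx> of_nat b \<longleftrightarrow> [a = b] (mod p)"
  using congp_of_int_iff[of "int a" "int b"] by (simp add: cong_int_iff)

lemma congp_of_nat_0_iff: "of_nat a \<approx> 0 \<longleftrightarrow> p dvd a"
  using congp_of_nat_iff[of a 0] by (simp add: cong_0_iff)

lemma D_inverse:
  assumes "x \<in> D p" "\<not> x \<approx> 0" shows "inverse x \<in> D p"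
proof -
  obtain a b where ab: "\<not> int p dvd b" "x = of_int a / of_int b"
    using assms by (auto simp: D_iff_fraction[OF prime_p])
  have "\<not> int p dvd a"
  proof
    assume "int p dvd a"
    then obtain k where "a = int p * k" by auto
    moreover have "of_int k / of_int b \<in> D p" using ab(1) D_iff_fraction[OF prime_p] by blast
    ultimately have "x \<approx> 0" using ab(2) by (intro congpI[of _ _ "of_int k / of_int b"]) auto
    then show False using assms by blast
  qed
  moreover have "inverse x = of_int b / of_int a" using ab by simp
  ultimately show ?thesis using D_iff_fraction[OF prime_p] by blast
qed

lemma D_divide: "x \<in> D p \<Longrightarrow> y \<in> D p \<Longrightarrow> \<not> y \<approx> 0 \<Longrightarrow> x / y \<in> D p"
  by (simp add: divide_inverse D_inverse D_mult)

lemma congp_cancel: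
  assumes "d \<in> D p" "\<not> d \<approx> 0" "d * x \<approx> d * y" shows "x \<approx> y"
proof -
  have "d \<noteq> 0" using assms(2) by auto
  with congp_lmult[OF D_inverse[OF assms(1,2)] assms(3)] show ?thesis
    by (simp flip: mult.assoc)
qed

lemma unit_of_nat: "\<not> p dvd a \<Longrightarrow> \<not> of_nat a \<approx> 0"
  by (simp add: congp_of_nat_0_iff)

lemma unit_mult:
  assumes "x \<in> D p" "\<not> x \<approx> 0" "\<not> y \<approx> 0" shows "\<not> x * y \<approx> 0"
  using congp_cancel[of x y 0] assms by auto

lemma not_dvd_numerals: "\<not> p dvd 2" "\<not> p dvd 3"
  using p_gt_3 by (auto dest: dvd_imp_le)

lemma units_2_3 [simp]: "\<not> 2 \<approx> 0" "\<not> 3 \<approx> 0"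
  using unit_of_nat[OF not_dvd_numerals(1)] unit_of_nat[OF not_dvd_numerals(2)] by simp_all

lemma unit_2_power: "\<not> 2 ^ k \<approx> 0"
  using unit_of_nat[of "2 ^ k"] not_dvd_numerals prime_dvd_power[OF prime_p] by auto

section \<open>Fermat's theorem and Euler's criterion for p-integral rationals\<close>

lemma ex_cong_of_nat:
  assumes "x \<in> D p" shows "\<exists>k::nat. x \<approx> of_nat k"
proof -
  obtain a b where ab: "\<not> int p dvd b" "x = of_int a / of_int b"
    using assms by (auto simp: D_iff_fraction[OF prime_p])
  have "coprime b (int p)"
    using ab(1) prime_p prime_imp_coprime[of "int p" b] by (simp add: coprime_commute)
  then obtain c where c: "[b * c = 1] (mod int p)" using cong_solve_coprime_int by blast
  have b0: "\<not> of_int b \<approx> 0" using ab(1) congp_of_int_iff[of b 0] by (simp add: cong_0_iff)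
  define k where "k = (a * c) mod int p"
  have k: "k \<ge> 0" "[k = a * c] (mod int p)" using prime_gt_0_nat[OF prime_p] by (auto simp: k_def)
  have "b \<noteq> 0" using ab by auto
  have "[b * k = a * (b * c)] (mod int p)"
    using cong_scalar_left[OF k(2), of b] by (simp add: ac_simps)
  also have "[a * (b * c) = a * 1] (mod int p)" by (intro cong_scalar_left c)
  finally have "of_int (b * k) \<approx> of_int a" by (simp only: congp_of_int_iff mult_1_right)
  then have "of_int b * of_int k \<approx> of_int b * x" using ab \<open>b \<noteq> 0\<close> by simp
  then have "x \<approx> of_int k" using congp_cancel[OF D_of_int b0] congp_sym by blast
  then show ?thesis using k(1) by (metis nonneg_int_cases of_int_of_nat_eq)
qed

lemma Fermat_unit:
  assumes "x \<in> D p" "\<not> x \<approx> 0" shows "x ^ (p - 1) \<approx> 1"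
proof -
  obtain k :: nat where k: "x \<approx> of_nat k" using ex_cong_of_nat assms by blast
  then have "\<not> p dvd k" using assms(2) congp_of_nat_0_iff congp_trans by blast
  then have "of_nat (k ^ (p - 1)) \<approx> of_nat 1"
    using fermat_theorem[OF prime_p] by (simp only: congp_of_nat_iff)
  with congp_power[OF k, of "p - 1"] show ?thesis
    using congp_trans[of "x ^ (p - 1)" "of_nat k ^ (p - 1)" 1] by simp
qed

text \<open>The additional factor \<open>x\<close> makes the congruence hold for non-units
  too.\<close>

lemma Fermat:
  assumes "x \<in> D p" shows "x * x ^ (p - 1) \<approx> x"
proof (cases "x \<approx> 0")
  case True
  then have "x ^ (p - 1) * x \<approx> x ^ (p - 1) * 0" using assms by (intro congp_lmult) auto
  then have "x * x ^ (p - 1) \<approx> 0" by (simp only: mult.commute mult_zero_left)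
  with True show ?thesis using congp_sym congp_trans by blast
next
  case False
  then show ?thesis using congp_lmult[OF assms Fermat_unit[OF assms]] by simp
qed

definition h :: nat where "h = (p - 1) div 2"

lemma p_eq: "p = 2 * h + 1"
  using prime_odd_nat[OF prime_p] p_gt_3 unfolding h_def by presburger

lemma h_ge_2: "h \<ge> 2" using p_eq p_gt_3 by simp

text \<open>Euler's criterion gives \<open>(a * b) ^ h\<close>, which is
  \<open>x ^ h * b ^ (p - 1)\<close> for x = a/b; the last power is 1 by Fermat.\<close>

lemma rat_Legendre_cong:
  assumes "x \<in> D p" shows "rat_Legendre x p \<approx> x ^ h"
proof -
  obtain a b where q: "quotient_of x = (a, b)" by (cases "quotient_of x")
  then have b: "\<not> int p dvd b" "x = of_int a / of_int b"
    using assms quotient_of_div by (auto simp: D_def)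
  then have b0: "\<not> of_int b \<approx> 0" using congp_of_int_iff[of b 0] by (simp add: cong_0_iff)
  have "b \<noteq> 0" using b by auto
  have "[Legendre (a * b) (int p) = (a * b) ^ ((nat (int p) - 1) div 2)] (mod int p)"
    using prime_p p_gt_3 euler_criterion[of "p" "a * b"] by simp
  then have "rat_Legendre x p \<approx> of_int ((a * b) ^ h)"
    unfolding rat_Legendre_def q h_def by (simp only: prod.case congp_of_int_iff nat_int)
  moreover have "p - 1 = h + h" using p_eq by simp
  then have "of_int ((a * b) ^ h) = x ^ h * of_int b ^ (p - 1)"
    using b \<open>b \<noteq> 0\<close> by (simp add: power_mult_distrib power_divide power_add)
  moreover have "x ^ h * of_int b ^ (p - 1) \<approx> x ^ h * 1"
    using assms b0 by (intro congp_lmult Fermat_unit) auto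
  ultimately show ?thesis using congp_trans by (simp only: mult_1_right)
qed

lemma D_sum [intro]: "(\<And>k. k \<in> I \<Longrightarrow> f k \<in> D p) \<Longrightarrow> sum f I \<in> D p"
  by (induction I rule: infinite_finite_induct) auto

lemma D_lucasU [simp, intro]: "c \<in> D p \<Longrightarrow> lucasU c k \<in> D p"
  by (induction c k rule: lucasU.induct) auto

lemma unit_less: "0 < a \<Longrightarrow> a < p \<Longrightarrow> \<not> of_nat a \<approx> 0"
  by (rule unit_of_nat) (auto dest: dvd_imp_le)

lemma p_cong_0: "of_nat p * x \<approx> 0" if "x \<in> D p"
  by (rule congpI[of _ _ x]) (use that in auto)

section \<open>Lucas sequences modulo a prime\<close>

text \<open>The analogue of sin (p w) / sin w = (2i sin w)^(p - 1) modulo p, with \<open>v\<close>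
  in the role of -4 sin^2 w. As \<open>2 * h + 1 = p\<close>, \<open>binomial_odd_sum\<close> leaves
  only the top coefficient.\<close>

lemma lucasU_half_add:
  assumes v: "v \<in> D p"
  shows "lucasU (v + 2) (Suc h) + lucasU (v + 2) h \<approx> v ^ h"
proof -
  let ?b = "\<lambda>k. ((h + k + 1) choose (2 * k + 1)) + ((h + k) choose (2 * k + 1))"
  have "of_nat (?b k) \<approx> 0" if "k < h" for k
  proof (rule congp_cancel)
    show "\<not> of_nat (2 * k + 1) \<approx> 0" using that p_eq by (intro unit_less) auto
    have "2 * of_nat h + 1 = (of_nat p :: rat)" by (subst p_eq) simp
    with binomial_odd_sum[of k h]
    have "of_nat (2 * k + 1) * of_nat (?b k) = of_nat p * (of_nat ((h + k) choose (2 * k)) :: rat)"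
      by (simp add: add.commute)
    then show "of_nat (2 * k + 1) * of_nat (?b k) \<approx> of_nat (2 * k + 1) * 0"
      using p_cong_0 by simp
  qed auto
  then have "v ^ k * of_nat (?b k) \<approx> v ^ k * 0" if "k < h" for k
    using that v congp_lmult by blast
  then have "(\<Sum>k<h. of_nat (?b k) * v ^ k) \<approx> (\<Sum>k<h. 0)"
    by (intro congp_sum) (simp add: mult.commute)
  then have "(\<Sum>k<h. of_nat (?b k) * v ^ k) + v ^ h \<approx> 0 + v ^ h"
    by (intro congp_add) auto
  moreover have bh: "?b h = 1"
    unfolding mult_2[symmetric] by (simp add: binomial_eq_0)
  have "lucasU (v + 2) (Suc h) + lucasU (v + 2) h = (\<Sum>k<h. of_nat (?b k) * v ^ k) + v ^ h"
    unfolding lucasU_add_eq_sum lessThan_Suc_atMost[symmetric] sum.lessThan_Suc bh by simp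
  ultimately show ?thesis by simp
qed

text \<open>Replacing w by pi/2 - w negates the parameter of the Lucas sequence and exchanges sums
  with differences, so this is the cosine version of \<open>lucasU_half_add\<close>.\<close>

lemma lucasU_half_diff:
  assumes v: "v \<in> D p"
  shows "lucasU (v - 2) (Suc h) - lucasU (v - 2) h \<approx> v ^ h"
proof -
  have "lucasU (- v + 2) (Suc h) + lucasU (- v + 2) h \<approx> (- v) ^ h"
    using v by (intro lucasU_half_add) auto
  moreover have "lucasU (- v + 2) k = (- 1) ^ Suc k * lucasU (v - 2) k" for k
    using lucasU_uminus[of "v - 2" k] by simp
  ultimately have "(- 1) ^ h * (lucasU (v - 2) (Suc h) - lucasU (v - 2) h) \<approx> (- 1) ^ h * v ^ h"
    by (simp add: algebra_simps power_minus[of v])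
  from congp_lmult[OF _ this, of "(- 1) ^ h"]
  have "(- 1) ^ h * ((- 1) ^ h * (lucasU (v - 2) (Suc h) - lucasU (v - 2) h))
      \<approx> (- 1) ^ h * ((- 1) ^ h * v ^ h)" by (simp only: D_power D_uminus D_numeral)
  then show ?thesis by (simp flip: mult.assoc power_mult_distrib)
qed

definition n :: nat where "n = p div 6"

lemma p_mod_6: "p = 6 * n + 1 \<or> p = 6 * n + 5"
proof -
  have "\<not> 2 dvd p" "\<not> 3 dvd p"
    using prime_p p_gt_3 by (auto simp: prime_nat_iff)
  then show ?thesis unfolding n_def by presburger
qed

text \<open>The sign with \<open>3 * (2 * n + 1) = p + 2 * \<epsilon>\<close>; it equals the Legendre symbol of \<open>-3\<close>.\<close>

definition \<epsilon> :: rat where "\<epsilon> = (if p = 6 * n + 1 then 1 else - 1)"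

lemma eps_cases:
  obtains "p = 6 * n + 1" "h = 3 * n" "\<epsilon> = 1" | "p = 6 * n + 5" "h = 3 * n + 2" "\<epsilon> = - 1"
  using p_mod_6 p_eq unfolding \<epsilon>_def by (cases "p = 6 * n + 1") auto

lemma D_eps [simp, intro]: "\<epsilon> \<in> D p" unfolding \<epsilon>_def by auto

lemma eps_square: "\<epsilon> * \<epsilon> = 1" unfolding \<epsilon>_def by auto

lemma minus3_power_h: "(- 3) ^ h \<approx> \<epsilon>"
proof -
  \<comment> \<open>At \<open>c = - 1\<close> the Lucas sequence has period 3, so its value near \<open>h\<close> is known exactly.\<close>
  have "lucasU (- 1 :: rat) (3 * n) = 0 \<and> lucasU (- 1 :: rat) (Suc (3 * n)) = 1" for n
    by (induction n) (simp_all add: numeral_3_eq_3)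
  moreover have "lucasU (- 3 + 2 :: rat) (Suc h) + lucasU (- 3 + 2) h \<approx> (- 3) ^ h"
    by (rule lucasU_half_add) auto
  ultimately show ?thesis
    by (cases rule: eps_cases) (auto simp: numeral_2_eq_2 intro: congp_sym)
qed

section \<open>The sums modulo a prime\<close>

text \<open>Modulo p both sides obey the same recurrence: (6k + 1)(6k + 5) + 36 (n + k + 1)(n - k)
  equals (6n + 1)(6n + 5), a multiple of p. The bound \<open>k < h\<close> keeps every divisor
  \<open>2 * k + 1\<close> below p. The base -432 arises from v = -4 sin^2 z = -432 x.\<close>

lemma S_low:
  assumes "k < h"
  shows "S k \<in> D p \<and> of_nat (2 * (2 * k + 1)) * S k \<approx> of_nat ((n + k) choose (2 * k)) * (- 432) ^ k"
  using assms
proof (induction k)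
  case 0
  show ?case using D_divide[of 1 2] by (simp add: S_def)
next
  case (Suc k)
  let ?b = "\<lambda>k. of_nat ((n + k) choose (2 * k)) * (- 432 :: rat) ^ k"
  from Suc have IH: "S k \<in> D p" "of_nat (2 * (2 * k + 1)) * S k \<approx> ?b k" by auto
  have u: "\<not> of_nat (k + 1) \<approx> 0" "\<not> of_nat (2 * k + 3) \<approx> 0" "\<not> of_nat (2 * k + 1) \<approx> 0"
    by (rule unit_less; use Suc.prems p_eq in simp)+
  have u3: "\<not> of_nat (k + 1) * of_nat (2 * k + 3) \<approx> 0" "\<not> of_nat (k + 1) * of_nat (2 * k + 1) \<approx> 0"
    by (rule unit_mult; use u in simp)+
  have "of_nat (k + 1) * of_nat (2 * k + 3) \<noteq> (0 :: rat)" using u3 by auto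
  then have "S (Suc k) = of_nat (6 * (6 * k + 1) * (6 * k + 5)) * S k / (of_nat (k + 1) * of_nat (2 * k + 3))"
    using S_step[of k] by (metis nonzero_mult_div_cancel_left)
  then have S1: "S (Suc k) \<in> D p" using D_divide[OF _ _ u3(1)] IH(1) by (metis D_mult D_of_nat)
  have "of_nat (k + 1) * of_nat (2 * k + 1) * (of_nat (2 * (2 * Suc k + 1)) * S (Suc k))
      = 2 * of_nat (2 * k + 1) * (of_nat (k + 1) * of_nat (2 * k + 3) * S (Suc k))"
    by (simp add: algebra_simps)
  also have "\<dots> = of_nat (6 * (6 * k + 1) * (6 * k + 5)) * (of_nat (2 * (2 * k + 1)) * S k)"
    unfolding S_step by (simp add: algebra_simps)
  also have "\<dots> \<approx> of_nat (6 * (6 * k + 1) * (6 * k + 5)) * ?b k"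
    using IH(2) by (intro congp_lmult) auto
  also have "\<dots> \<approx> - 216 * (of_nat n + of_nat k + 1) * (of_nat n - of_nat k) * ?b k"
  proof -
    \<comment> \<open>\<open>q\<close> is the cofactor of \<open>p\<close> in (6n + 1)(6n + 5),
      whichever residue \<open>p\<close> has modulo 6.\<close>
    define q where "q = (if p = 6 * n + 1 then 6 * n + 5 else 6 * n + 1)"
    have "of_nat ((6 * n + 1) * (6 * n + 5)) = (of_nat (p * q) :: rat)"
      unfolding q_def using p_mod_6 by (auto simp only: mult.commute split: if_splits)
    then have "of_nat p * of_nat q = (6 * of_nat n + 1) * (6 * of_nat n + 5 :: rat)"
      by (simp add: algebra_simps)
    then have "of_nat p * (6 * of_nat q * ?b k) = 6 * ((6 * of_nat n + 1) * (6 * of_nat n + 5)) * ?b k"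
      by (metis mult.assoc mult.left_commute)
    then show ?thesis
      by (intro congpI[of _ _ "6 * of_nat q * ?b k"]) (auto simp: algebra_simps)
  qed
  also have "\<dots> = - 216 * ((of_nat n + of_nat k + 1) * (of_nat n - of_nat k) * of_nat ((n + k) choose (2 * k))) * (- 432) ^ k"
    by (simp only: mult.assoc)
  also have "\<dots> = of_nat (k + 1) * of_nat (2 * k + 1) * ?b (Suc k)"
    unfolding binomial_even_step[symmetric] by (simp add: algebra_simps)
  finally have "of_nat (2 * (2 * Suc k + 1)) * S (Suc k) \<approx> ?b (Suc k)"
    using congp_cancel[OF _ u3(2)] by (metis D_mult D_of_nat)
  with S1 show ?case by blast
qed

text \<open>
  The recurrence of \<open>S\<close> divides by \<open>p\<close> in the step from \<open>h - 1\<close> to \<open>h\<close>, so \<open>S h\<close> needs a separate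
  evaluation.
\<close>

lemma S_h: "S h \<in> D p \<and> 4 * S h \<approx> - 1"
proof -
  define w X Y V z where "w = (2 * h - 2) choose (h - 1)" and "X = (6 * h) choose (3 * h)"
    and "Y = (3 * h) choose h" and "V = (3 * h) choose p" and "z = (2 * h) choose h"
  have p3: "p + (p + (2 * h - 2)) = 6 * h" "p + (h - 1) = 3 * h" "3 * h - p = h - 1" "p \<le> 3 * h"
    using p_eq h_ge_2 by auto
  \<comment> \<open>Since 6h = 2p + (2h - 2), the prime is split off twice; each of the two
    resulting binomials reduces to the central one \<open>w\<close>.\<close>
  have "[X = ((p + (2 * h - 2)) choose (3 * h)) + ((p + (2 * h - 2)) choose (h - 1))] (mod p)"
    using binomial_add_prime_cong[OF prime_p, of "p + (2 * h - 2)" "3 * h"]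
    unfolding X_def p3(1,3) using p3(4) by simp
  also have "[((p + (2 * h - 2)) choose (3 * h)) + ((p + (2 * h - 2)) choose (h - 1)) = w + w] (mod p)"
  proof (rule cong_add)
    show "[(p + (2 * h - 2)) choose (3 * h) = w] (mod p)"
      using binomial_add_prime_cong[OF prime_p, of "2 * h - 2" "3 * h"] p3(4) h_ge_2
      unfolding w_def p3(3) by (simp add: binomial_eq_0)
    show "[(p + (2 * h - 2)) choose (h - 1) = w] (mod p)"
      using binomial_add_prime_cong[OF prime_p, of "2 * h - 2" "h - 1"]
      unfolding w_def using p3(2) h_ge_2 p_eq by (simp split: if_splits)
  qed
  finally have X: "of_nat X \<approx> of_nat (w + w)" by (simp only: congp_of_nat_iff)
  have "[V = 1] (mod p)"
    using binomial_add_prime_cong[OF prime_p, of "h - 1" p] p_eq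
    unfolding V_def p3(2) by (simp add: binomial_eq_0)
  then have V: "of_nat V \<approx> of_nat 1" by (simp only: congp_of_nat_iff)
  \<comment> \<open>The denominator of \<open>S h\<close> contains \<open>2 * h + 1 = p\<close>;
    this identity exhibits the factor \<open>p\<close> of \<open>Y\<close> that cancels it.\<close>
  have "p * V = h * Y"
  proof -
    have "Suc (2 * h) * ((3 * h) choose Suc (2 * h)) = h * ((3 * h) choose (2 * h))"
      using binomial_absorption[of "2 * h" "3 * h"] binomial_absorb_comp[of "3 * h" "2 * h"] by auto
    moreover have "Suc (2 * h) = p" "(3 * h) choose (2 * h) = (3 * h) choose h"
      using p_eq binomial_symmetric[of h "3 * h"] by simp_all
    ultimately show ?thesis by (simp only: V_def Y_def)
  qed
  then have hY: "of_nat h * of_nat Y = (of_nat p * of_nat V :: rat)" by (metis of_nat_mult)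
  \<comment> \<open>The ratio of consecutive central binomials; with 2h = -1 modulo p it says that
    \<open>z\<close> is 8w.\<close>
  have "h * z = 2 * (2 * h - 1) * w"
  proof -
    obtain g where g: "h = Suc g" using h_ge_2 by (cases h) auto
    have "Suc g * (Suc (Suc (2 * g)) choose Suc g) = Suc (Suc (2 * g)) * (Suc (2 * g) choose g)"
      using Suc_times_binomial_eq[of "Suc (2 * g)" g] by (simp add: mult.commute)
    moreover have "Suc g * (Suc (2 * g) choose g) = Suc (2 * g) * ((2 * g) choose g)"
      using binomial_absorb_comp[of "Suc (2 * g)" g] by simp
    ultimately have "Suc g * z = 2 * (Suc (2 * g) * w)" unfolding z_def w_def g by (simp add: algebra_simps)
    then show ?thesis unfolding g by (simp add: algebra_simps)
  qed
  then have "of_nat (h * z) = (of_nat (2 * (2 * h - 1) * w) :: rat)" by simp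
  moreover have "of_nat (2 * h - 1) = (2 * of_nat h - 1 :: rat)" using h_ge_2 by (simp add: of_nat_diff)
  ultimately have hz: "of_nat h * of_nat z = (2 * (2 * of_nat h - 1) * of_nat w :: rat)"
    by (simp only: of_nat_mult of_nat_numeral)
  have ph: "of_nat p = (2 * of_nat h + 1 :: rat)" by (subst p_eq) simp
  have "\<not> p dvd z"
  proof
    assume "p dvd z"
    then have "p dvd fact h * fact (2 * h - h) * z" by simp
    then have "p dvd fact (2 * h)"
      using binomial_fact_lemma[of h "2 * h"] unfolding z_def by simp
    then show False using prime_dvd_fact_iff[OF prime_p] p_eq by simp
  qed
  then have z: "\<not> of_nat z \<approx> 0" by (rule unit_of_nat)
  then have "z \<noteq> 0" by (metis congp_refl of_nat_0)
  have h2: "\<not> of_nat (2 * h) \<approx> 0" using p_eq h_ge_2 by (intro unit_less) auto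
  have u: "\<not> of_nat (2 * h) * of_nat z \<approx> 0" using h2 z by (intro unit_mult) auto
  have Sh: "of_nat (2 * h) * of_nat z * S h = of_nat X * of_nat V"
  proof -
    have "S h = of_nat X * of_nat Y / (2 * of_nat z * of_nat p)"
      unfolding S_def X_def Y_def z_def by (subst p_eq) (simp only: of_nat_mult of_nat_numeral)
    moreover have "p \<noteq> 0" using p_gt_3 by simp
    ultimately have "of_nat (2 * h) * of_nat z * S h * of_nat p = of_nat X * (of_nat h * of_nat Y)"
      using \<open>z \<noteq> 0\<close> by (simp add: field_simps)
    then have "of_nat p * (of_nat (2 * h) * of_nat z * S h) = of_nat p * (of_nat X * of_nat V :: rat)"
      unfolding hY by (simp only: ac_simps)
    with \<open>p \<noteq> 0\<close> show ?thesis by simp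
  qed
  have "of_nat (2 * h) * of_nat z \<noteq> (0 :: rat)" using u by (metis congp_refl)
  then have "S h = of_nat X * of_nat V / (of_nat (2 * h) * of_nat z)"
    using Sh by (metis nonzero_mult_div_cancel_left)
  then have D: "S h \<in> D p" using D_divide[OF _ _ u] by (metis D_mult D_of_nat)
  have XV: "of_nat X * of_nat V \<approx> of_nat (w + w) * of_nat 1"
    using X V by (intro congp_mult) auto
  \<comment> \<open>Again 2h is -1 modulo p, so the product formula \<open>Sh\<close> yields -4 z
    S(h) = 8w = z.\<close>
  have "- (of_nat z * (4 * S h)) \<approx> 4 * (of_nat (2 * h) * of_nat z * S h)"
    using D by (intro congpI[of _ _ "- 4 * of_nat z * S h"]) (auto simp: ph algebra_simps)
  also have "\<dots> \<approx> 4 * (of_nat (w + w) * of_nat 1)"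
    unfolding Sh using XV by (intro congp_lmult) auto
  also have "\<dots> \<approx> of_nat z"
    using hz by (intro congpI[of _ _ "4 * of_nat w - of_nat z"])
      (auto simp: ph algebra_simps)
  finally have "- 1 * (- (of_nat z * (4 * S h))) \<approx> - 1 * of_nat z" by (intro congp_lmult) auto
  then have "of_nat z * (4 * S h) \<approx> of_nat z * (- 1)" by simp
  then have "4 * S h \<approx> - 1" by (rule congp_cancel[OF D_of_nat z])
  with D show ?thesis by blast
qed

text \<open>The order \<open>(p - \<epsilon>) / 3\<close> of the Chebyshev polynomial for the upper
  range. Its square is 1/9 modulo p, matching the parameters -1/3 and 1/3 of the second
  series.\<close>

definition m :: nat where "m = (if p = 6 * n + 1 then 2 * n else 2 * n + 2)"

lemma m_pos: "m > 0" using p_gt_3 unfolding m_def by auto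

lemma m_le_h: "m \<le> h" by (cases rule: eps_cases) (auto simp: m_def)

lemma m_eq: "3 * of_nat m = of_nat p - \<epsilon>"
  by (cases rule: eps_cases) (auto simp: m_def)

lemma D_chebT_coeff [simp, intro]: "chebT_coeff k j \<in> D p"
  unfolding chebT_coeff_def by auto

text \<open>Past the critical index the recurrence is regular again: putting k = h + j and 2h = -1
  modulo p turns it into \<open>chebT_coeff_step\<close>. \<open>S_h\<close> supplies the initial
  value, where \<open>chebT_coeff m 0\<close> is 2.\<close>

lemma S_high:
  assumes "j \<le> h"
  shows "S (h + j) \<in> D p \<and> 8 * S (h + j) \<approx> - chebT_coeff m j * (- 432) ^ j"
  using assms
proof (induction j)
  case 0
  have "2 * (4 * S h) \<approx> 2 * - 1" using S_h by (intro congp_lmult) auto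
  then show ?case using S_h by (simp add: chebT_coeff_def)
next
  case (Suc j)
  let ?b = "\<lambda>j. - chebT_coeff m j * (- 432) ^ j"
  define J P :: rat where "J = of_nat j" and "P = of_nat p"
  from Suc have IH: "S (h + j) \<in> D p" "8 * S (h + j) \<approx> ?b j" by auto
  have DJ [simp]: "J \<in> D p" "P \<in> D p" by (auto simp: J_def P_def)
  have ph: "of_nat h = (P - 1) / 2"
    using arg_cong[OF p_eq, of "of_nat :: nat \<Rightarrow> rat"] by (simp add: P_def)
  have "\<not> p dvd 2 * (h + j) + 3"
  proof
    assume "p dvd 2 * (h + j) + 3"
    moreover have "2 * (h + j) + 3 = p + (2 * j + 2)" using p_eq by simp
    ultimately have "p dvd 2 * j + 2" by (metis dvd_add_triv_left_iff)
    then show False using Suc.prems p_eq by (auto dest!: dvd_imp_le)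
  qed
  then have u1: "\<not> of_nat (2 * (h + j) + 3) \<approx> 0" by (rule unit_of_nat)
  have u2: "\<not> of_nat (h + j + 1) \<approx> 0" using Suc.prems p_eq by (intro unit_less) auto
  have u3: "\<not> of_nat (h + j + 1) * of_nat (2 * (h + j) + 3) \<approx> 0"
    using u1 u2 by (intro unit_mult) auto
  have "\<not> of_nat (2 * j + 1) \<approx> 0" "\<not> of_nat (2 * j + 2) \<approx> 0"
    by (rule unit_less; use Suc.prems p_eq in simp)+
  then have u4: "\<not> of_nat (2 * j + 1) * of_nat (2 * j + 2) \<approx> 0" by (intro unit_mult) auto
  have "of_nat (h + j + 1) * of_nat (2 * (h + j) + 3) \<noteq> (0 :: rat)" using u3 by auto
  then have "S (Suc (h + j)) = of_nat (6 * (6 * (h + j) + 1) * (6 * (h + j) + 5)) * S (h + j)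
      / (of_nat (h + j + 1) * of_nat (2 * (h + j) + 3))"
    using S_step[of "h + j"] by (metis nonzero_mult_div_cancel_left)
  then have S1: "S (Suc (h + j)) \<in> D p" using D_divide[OF _ _ u3] IH(1) by (metis D_mult D_of_nat)
  \<comment> \<open>With h replaced by (P - 1)/2, every occurrence of the prime is explicit and the
    reductions below become polynomial identities in \<open>P\<close>.\<close>
  have step: "(2 * J + 1 + P) * (2 * J + 2 + P) * S (Suc (h + j))
      = 12 * ((3 * P + 6 * J) ^ 2 - 4) * S (h + j)"
  proof -
    have "(of_nat (h + j + 1) :: rat) = (2 * J + 1 + P) / 2"
      "(of_nat (2 * (h + j) + 3) :: rat) = 2 * J + 2 + P"
      "(of_nat (6 * (6 * (h + j) + 1) * (6 * (h + j) + 5)) :: rat) = 6 * ((3 * P + 6 * J) ^ 2 - 4)"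
      by (simp_all add: ph J_def[symmetric] field_simps power2_eq_square)
    with S_step[of "h + j"] have "(2 * J + 1 + P) / 2 * (2 * J + 2 + P) * S (Suc (h + j))
        = 6 * ((3 * P + 6 * J) ^ 2 - 4) * S (h + j)" by (simp only:)
    then show ?thesis by simp
  qed
  have m9: "9 * of_nat m ^ 2 = (P - \<epsilon>) ^ 2"
    unfolding P_def m_eq[symmetric] by (simp add: power_mult_distrib)
  have "of_nat (2 * j + 1) * of_nat (2 * j + 2) * (8 * S (h + Suc j))
      \<approx> 8 * ((2 * J + 1 + P) * (2 * J + 2 + P) * S (Suc (h + j)))"
    using S1 by (intro congpI[of _ _ "- 8 * (4 * J + 3 + P) * S (Suc (h + j))"])
      (auto simp: P_def[symmetric] J_def[symmetric] algebra_simps)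
  also have "\<dots> = 12 * ((3 * P + 6 * J) ^ 2 - 4) * (8 * S (h + j))" unfolding step by simp
  also have "\<dots> \<approx> 12 * ((3 * P + 6 * J) ^ 2 - 4) * ?b j"
    using IH(2) by (intro congp_lmult) auto
  \<comment> \<open>Both factors are 12 (36 J^2 - 4) modulo p, because \<open>\<epsilon>\<close>
    squares to 1; the new form contains \<open>(P - \<epsilon>) ^ 2\<close>, which is exactly 9
    m^2.\<close>
  also have "\<dots> \<approx> - 48 * ((P - \<epsilon>) ^ 2 - 9 * J ^ 2) * ?b j"
    by (intro congpI[of _ _ "12 * (9 * P + 36 * J + 4 * P - 8 * \<epsilon>) * ?b j"])
      (auto simp: P_def[symmetric] algebra_simps power2_eq_square eps_square)
  also have "\<dots> = 432 * ((of_nat m ^ 2 - of_nat j ^ 2) * chebT_coeff m j) * (- 432) ^ j"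
    unfolding m9[symmetric] J_def by (simp add: algebra_simps)
  also have "\<dots> = of_nat (2 * j + 1) * of_nat (2 * j + 2) * ?b (Suc j)"
    unfolding chebT_coeff_step[OF m_pos, symmetric] by (simp add: algebra_simps)
  finally have "8 * S (h + Suc j) \<approx> ?b (Suc j)"
    using congp_cancel[OF _ u4] by (metis D_mult D_of_nat)
  with S1 show ?case by simp
qed

section \<open>Summation over the lower, middle and upper ranges\<close>

lemma n_less_h: "n < h"
  by (cases rule: eps_cases) (use h_ge_2 in auto)

text \<open>\<open>binomial_odd_sum\<close> trades the denominator \<open>2 * k + 1\<close> of each
  term for the constant \<open>2 * n + 1\<close>.\<close>

lemma sum_S_low:
  assumes x: "x \<in> D p"
  shows "2 * (2 * of_nat n + 1) * (\<Sum>k = 0..n. S k * x ^ k)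
    \<approx> lucasU (- 432 * x + 2) (Suc n) + lucasU (- 432 * x + 2) n"
proof -
  let ?r = "\<lambda>k. of_nat (((n + k + 1) choose (2 * k + 1)) + ((n + k) choose (2 * k + 1))) :: rat"
  have "2 * (2 * of_nat n + 1) * S k \<approx> ?r k * (- 432) ^ k" if "k \<le> n" for k
  proof (rule congp_cancel)
    have "k < h" using that n_less_h by simp
    then have u: "\<not> of_nat (2 * k + 1) \<approx> 0" using p_eq by (intro unit_less) auto
    then show "\<not> of_nat (2 * k + 1) \<approx> 0" .
    have "of_nat (2 * k + 1) * (2 * (2 * of_nat n + 1) * S k)
        = (2 * of_nat n + 1) * (of_nat (2 * (2 * k + 1)) * S k)" by (simp add: algebra_simps)
    also have "\<dots> \<approx> (2 * of_nat n + 1) * (of_nat ((n + k) choose (2 * k)) * (- 432) ^ k)"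
      using S_low[OF \<open>k < h\<close>] by (intro congp_lmult) auto
    also have "\<dots> = of_nat (2 * k + 1) * (?r k * (- 432) ^ k)"
      unfolding mult.assoc[symmetric] binomial_odd_sum[symmetric] by simp
    finally show "of_nat (2 * k + 1) * (2 * (2 * of_nat n + 1) * S k)
        \<approx> of_nat (2 * k + 1) * (?r k * (- 432) ^ k)" .
  qed auto
  then have "x ^ k * (2 * (2 * of_nat n + 1) * S k) \<approx> x ^ k * (?r k * (- 432) ^ k)" if "k \<le> n" for k
    using x that congp_lmult by blast
  then have "(\<Sum>k\<le>n. x ^ k * (2 * (2 * of_nat n + 1) * S k)) \<approx> (\<Sum>k\<le>n. x ^ k * (?r k * (- 432) ^ k))"
    by (intro congp_sum) simp
  then show ?thesis unfolding lucasU_add_eq_sum power_mult_distrib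
    by (simp only: atLeast0AtMost sum_distrib_left ac_simps)
qed

text \<open>The weight \<open>2 * k + 1\<close> cancels the denominator, leaving the even binomials
  and hence a Lucas difference in place of a sum.\<close>

lemma sum_odd_S_low:
  assumes x: "x \<in> D p"
  shows "2 * (\<Sum>k = 0..n. of_nat (2 * k + 1) * S k * x ^ k)
    \<approx> lucasU (- 432 * x + 2) (Suc n) - lucasU (- 432 * x + 2) n"
proof -
  let ?r = "\<lambda>k. of_nat ((n + k) choose (2 * k)) :: rat"
  have "x ^ k * (of_nat (2 * (2 * k + 1)) * S k) \<approx> x ^ k * (?r k * (- 432) ^ k)" if "k \<le> n" for k
    using x that congp_lmult S_low[of k] n_less_h by (meson D_power le_less_trans)
  then have "(\<Sum>k\<le>n. x ^ k * (of_nat (2 * (2 * k + 1)) * S k)) \<approx> (\<Sum>k\<le>n. x ^ k * (?r k * (- 432) ^ k))"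
    by (intro congp_sum) simp
  then show ?thesis unfolding lucasU_diff_eq_sum power_mult_distrib of_nat_mult[of 2] of_nat_numeral
    by (simp only: atLeast0AtMost sum_distrib_left ac_simps)
qed

text \<open>For k > n the binomial in \<open>S_low\<close> has lower index 2k > n + k and is
  zero.\<close>

lemma S_middle:
  assumes "n < k" "k < h" shows "S k \<approx> 0"
proof (rule congp_cancel)
  show "\<not> of_nat (2 * (2 * k + 1)) \<approx> 0"
    unfolding of_nat_mult
    by (rule unit_mult) (use unit_less[of "2 * k + 1"] assms p_eq in auto)
  show "of_nat (2 * (2 * k + 1)) * S k \<approx> of_nat (2 * (2 * k + 1)) * 0"
    using S_low[OF assms(2)] assms(1) by (simp add: binomial_eq_0)
qed auto

text \<open>The weight \<open>w\<close> lets one splitting serve both the plain and the odd-weighted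
  sums; the last range is \<open>h..2 * h\<close> because p - 1 = 2h.\<close>

lemma sum_split_S:
  assumes x: "x \<in> D p" and w: "\<And>k. w k \<in> D p"
  shows "(\<Sum>k = 0..p - 1. w k * S k * x ^ k)
    \<approx> (\<Sum>k = 0..n. w k * S k * x ^ k) + x ^ h * (\<Sum>j\<le>h. w (h + j) * S (h + j) * x ^ j)"
proof -
  let ?f = "\<lambda>k. w k * S k * x ^ k"
  have "{0..p - 1} = {0..n} \<union> ({n<..<h} \<union> {h..h + h})" using n_less_h p_eq by auto
  moreover have "sum ?f ({0..n} \<union> ({n<..<h} \<union> {h..h + h})) = sum ?f {0..n} + (sum ?f {n<..<h} + sum ?f {h..h + h})"
    using n_less_h by (subst sum.union_disjoint; (subst sum.union_disjoint)?; auto)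
  moreover have "sum ?f {h..h + h} = x ^ h * (\<Sum>j\<le>h. w (h + j) * S (h + j) * x ^ j)"
    using sum.shift_bounds_cl_nat_ivl[of ?f 0 h h]
    by (simp add: sum_distrib_left power_add atLeast0AtMost ac_simps)
  moreover have "(w k * x ^ k) * S k \<approx> (w k * x ^ k) * 0" if "k \<in> {n<..<h}" for k
    using that x w S_middle by (intro congp_lmult) auto
  then have "sum ?f {n<..<h} \<approx> (\<Sum>k\<in>{n<..<h}. 0)" by (intro congp_sum) (simp add: ac_simps)
  then have "sum ?f {0..n} + (sum ?f {n<..<h} + sum ?f {h..h + h}) \<approx> sum ?f {0..n} + (0 + sum ?f {h..h + h})"
    by (intro congp_add) auto
  ultimately show ?thesis by simp
qed

text \<open>Each coefficient is a sum of two even binomials, so the total is U(m + 1) - U(m - 1),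
  that is 2 cos (2 m w) for \<open>v + 2\<close> equal to 2 cos (2w). Summing up to \<open>h\<close>
  is harmless, as the coefficients vanish beyond \<open>m\<close>.\<close>

lemma sum_chebT:
  "(\<Sum>j\<le>h. chebT_coeff m j * v ^ j) = 2 * lucasU (v + 2) (Suc m) - (v + 2) * lucasU (v + 2) m"
proof -
  obtain l where l: "m = Suc l" using m_pos by (cases m) auto
  have "(\<Sum>j\<le>h. chebT_coeff m j * v ^ j) = (\<Sum>j\<le>m. chebT_coeff m j * v ^ j)"
    using m_le_h by (intro sum.mono_neutral_right) (auto simp: chebT_coeff_def binomial_eq_0)
  also have "\<dots> = (\<Sum>j\<le>m. of_nat ((m + j) choose (2 * j)) * v ^ j)
      + (\<Sum>j\<le>m. of_nat ((l + j) choose (2 * j)) * v ^ j)"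
    by (simp add: chebT_coeff_def l sum.distrib[symmetric] algebra_simps)
  also have "(\<Sum>j\<le>m. of_nat ((l + j) choose (2 * j)) * v ^ j)
      = (\<Sum>j\<le>l. of_nat ((l + j) choose (2 * j)) * v ^ j)"
    by (simp add: l binomial_eq_0)
  finally show ?thesis
    unfolding lucasU_diff_eq_sum[symmetric] by (simp add: l algebra_simps)
qed

lemma sum_index_chebT:
  "(\<Sum>j\<le>h. of_nat j * chebT_coeff m j * v ^ j) = of_nat m * v * lucasU (v + 2) m"
proof -
  obtain l where l: "m = Suc l" using m_pos by (cases m) auto
  have "(\<Sum>j\<le>h. of_nat j * chebT_coeff m j * v ^ j) = (\<Sum>j\<le>m. of_nat j * chebT_coeff m j * v ^ j)"
    using m_le_h by (intro sum.mono_neutral_right) (auto simp: chebT_coeff_def binomial_eq_0)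
  also have "\<dots> = (\<Sum>j\<le>l. of_nat (Suc j) * chebT_coeff m (Suc j) * v ^ Suc j)"
    unfolding l by (subst sum.atMost_Suc_shift) simp
  also have "\<dots> = of_nat m * v * (\<Sum>j\<le>l. of_nat ((m + j) choose (2 * j + 1)) * v ^ j)"
    unfolding chebT_coeff_times_index[OF m_pos] by (simp add: sum_distrib_left ac_simps)
  also have "(\<Sum>j\<le>l. of_nat ((m + j) choose (2 * j + 1)) * v ^ j)
      = (\<Sum>j\<le>m. of_nat ((m + j) choose (2 * j + 1)) * v ^ j)"
    by (simp add: l binomial_eq_0)
  finally show ?thesis unfolding lucasU_eq_sum[symmetric] .
qed

lemma sum_S_high:
  assumes x: "x \<in> D p"
  shows "8 * (\<Sum>j\<le>h. S (h + j) * x ^ j)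
    \<approx> - (2 * lucasU (- 432 * x + 2) (Suc m) - (- 432 * x + 2) * lucasU (- 432 * x + 2) m)"
proof -
  have "x ^ j * (8 * S (h + j)) \<approx> x ^ j * (- chebT_coeff m j * (- 432) ^ j)" if "j \<le> h" for j
    using x that S_high[of j] by (intro congp_lmult) auto
  then have "(\<Sum>j\<le>h. x ^ j * (8 * S (h + j))) \<approx> (\<Sum>j\<le>h. x ^ j * (- chebT_coeff m j * (- 432) ^ j))"
    by (intro congp_sum) simp
  moreover have "(\<Sum>j\<le>h. x ^ j * (- chebT_coeff m j * (- 432) ^ j))
      = - (\<Sum>j\<le>h. chebT_coeff m j * (- 432 * x) ^ j)"
    unfolding sum_negf[symmetric] power_mult_distrib by (simp add: ac_simps)
  ultimately show ?thesis unfolding sum_chebT by (simp add: sum_distrib_left ac_simps)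
qed

text \<open>Because 2h + 1 = p, the weight is 2j modulo p, which brings in the index-weighted
  Chebyshev sum.\<close>

lemma sum_odd_S_high:
  assumes x: "x \<in> D p"
  shows "4 * (\<Sum>j\<le>h. of_nat (2 * (h + j) + 1) * S (h + j) * x ^ j)
    \<approx> - (of_nat m * (- 432 * x) * lucasU (- 432 * x + 2) m)"
proof -
  have "4 * (of_nat (2 * (h + j) + 1) * S (h + j) * x ^ j)
      \<approx> - (of_nat j * chebT_coeff m j * (- 432 * x) ^ j)" if "j \<le> h" for j
  proof -
    have odd: "of_nat (2 * (h + j) + 1) = (of_nat p + 2 * of_nat j :: rat)" by (subst p_eq) simp
    have "4 * (of_nat (2 * (h + j) + 1) * S (h + j) * x ^ j) \<approx> (of_nat j * x ^ j) * (8 * S (h + j))"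
      unfolding odd using x S_high[OF that]
      by (intro congpI[of _ _ "4 * S (h + j) * x ^ j"]) (auto simp: algebra_simps)
    also have "\<dots> \<approx> (of_nat j * x ^ j) * (- chebT_coeff m j * (- 432) ^ j)"
      using x S_high[OF that] by (intro congp_lmult) auto
    also have "\<dots> = - (of_nat j * chebT_coeff m j * (- 432 * x) ^ j)"
      unfolding power_mult_distrib by simp
    finally show ?thesis .
  qed
  then have "(\<Sum>j\<le>h. 4 * (of_nat (2 * (h + j) + 1) * S (h + j) * x ^ j))
      \<approx> (\<Sum>j\<le>h. - (of_nat j * chebT_coeff m j * (- 432 * x) ^ j))"
    by (intro congp_sum) simp
  then show ?thesis unfolding sum_negf sum_index_chebT sum_distrib_left .
qed

end

section \<open>Trisection\<close>

locale prime_localization_point = prime_localization +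
  fixes t :: rat
  assumes t: "t \<in> D p"
begin

definition x :: rat where "x = t\<^sup>2 * (4 * t + 1)"
definition c :: rat where "c = - 1 - 12 * t"
text \<open>By Euler's criterion \<open>L\<close> and \<open>A\<close> stand for the two Legendre
  symbols; the Lucas congruences produce them in this power form.\<close>

definition L :: rat where "L = (1 + 4 * t) ^ h"
definition A :: rat where "A = (1 - 12 * t) ^ h"
text \<open>With \<open>c = 2 * cos (2 w)\<close>, these are \<open>cos (p w) / cos w\<close> and \<open>sin (p w) / sin w\<close>.\<close>

definition a :: rat where "a = lucasU c (Suc h) - lucasU c h"
definition b :: rat where "b = lucasU c (Suc h) + lucasU c h"

lemma D_t [simp]: "t \<in> D p" "x \<in> D p" "c \<in> D p" "L \<in> D p" "A \<in> D p" "a \<in> D p" "b \<in> D p"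
  using t by (auto simp: x_def c_def L_def A_def a_def b_def)

text \<open>The trisection itself: both sides are 2 cos (6w), by sin^2 (3w) = 108 x on the left and
  by the triple-angle formula on the right.\<close>

lemma triple_arg: "- 432 * x + 2 = c ^ 3 - 3 * c"
  by (simp add: x_def c_def algebra_simps power2_eq_square power3_eq_cube)

lemma a_cong: "a \<approx> A"
  using lucasU_half_diff[of "1 - 12 * t"] by (auto simp: a_def c_def A_def)

text \<open>Here c - 2 = -3 (1 + 4t), and the h-th power of -3 contributes the sign
  \<open>\<epsilon>\<close>.\<close>

lemma b_cong: "b \<approx> \<epsilon> * L"
proof -
  have "b \<approx> (- 3 * (1 + 4 * t)) ^ h"
    using lucasU_half_add[of "- 3 * (1 + 4 * t)"] by (auto simp: b_def c_def algebra_simps)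
  also have "\<dots> = (- 3) ^ h * L" by (simp only: power_mult_distrib L_def)
  also have "\<dots> \<approx> \<epsilon> * L" using minus3_power_h by (intro congp_mult) auto
  finally show ?thesis .
qed

text \<open>Keeping the factor \<open>u\<close> allows squares of \<open>L\<close> and
  \<open>A\<close> to be removed even when 1 + 4t or 1 - 12t is divisible by p.\<close>

lemma Fermat_h: "u * (u ^ h * u ^ h) \<approx> u" if "u \<in> D p"
proof -
  have "p - 1 = h + h" using p_eq by simp
  then show ?thesis using Fermat[OF that] by (simp only: power_add)
qed

lemma A_square: "(1 - 12 * t) * (A * A) \<approx> 1 - 12 * t"
  unfolding A_def by (rule Fermat_h) auto

lemma L_square: "(1 + 4 * t) * (L * L) \<approx> 1 + 4 * t"
  unfolding L_def by (rule Fermat_h) auto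

lemma a_square: "(c + 2) * (a * a) \<approx> c + 2"
proof -
  have "(c + 2) * (a * a) \<approx> (c + 2) * (A * A)" using a_cong by (intro congp_lmult congp_mult) auto
  also have "\<dots> \<approx> c + 2" using A_square by (simp add: c_def)
  finally show ?thesis .
qed

lemma b_square: "(c - 2) * (b * b) \<approx> c - 2"
proof -
  have "(c - 2) * (b * b) \<approx> (c - 2) * ((\<epsilon> * L) * (\<epsilon> * L))"
    using b_cong by (intro congp_lmult congp_mult) auto
  also have "\<dots> = - 3 * ((1 + 4 * t) * (L * L)) * (\<epsilon> * \<epsilon>)" by (simp add: c_def algebra_simps)
  also have "\<dots> = - 3 * ((1 + 4 * t) * (L * L))" by (simp only: eps_square mult_1_right)
  also have "\<dots> \<approx> - 3 * (1 + 4 * t)" using L_square by (intro congp_lmult) auto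
  also have "\<dots> = c - 2" by (simp add: c_def algebra_simps)
  finally show ?thesis .
qed

lemma ab_cong: "a * b \<approx> \<epsilon> * (A * L)"
  using congp_mult[OF a_cong b_cong] by (simp add: ac_simps)

lemma x_power_h: "x ^ h = t ^ h * t ^ h * L"
  by (simp add: x_def L_def power_mult_distrib power2_eq_square add.commute)

section \<open>Lucas terms at the tripled indices, in terms of \<open>a\<close> and
  \<open>b\<close>\<close>

lemma lucasU_near_half:
  "lucasU c h = (b - a) / 2" "lucasU c (Suc h) = (a + b) / 2"
  "lucasU c (Suc (Suc h)) = c * ((a + b) / 2) - (b - a) / 2"
  "lucasU c (Suc (Suc (Suc h))) = c * (c * ((a + b) / 2) - (b - a) / 2) - (a + b) / 2"
  by (simp_all add: a_def b_def)

text \<open>Since 6n + 3 = \<open>p + 2 * \<epsilon>\<close>, these are the addition formulas for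
  sine and cosine of p w + 2 \<open>\<epsilon>\<close> w, divided by sin w and cos w.\<close>

lemma lucasU_low_index:
  "2 * (lucasU c (3 * n + 2) + lucasU c (3 * n + 1)) = c * b + \<epsilon> * (c + 2) * a"
  "2 * (lucasU c (3 * n + 2) - lucasU c (3 * n + 1)) = c * a + \<epsilon> * (c - 2) * b"
proof -
  have "2 * (lucasU c (3 * n + 2) + lucasU c (3 * n + 1)) = c * b + \<epsilon> * (c + 2) * a \<and>
      2 * (lucasU c (3 * n + 2) - lucasU c (3 * n + 1)) = c * a + \<epsilon> * (c - 2) * b"
  proof (cases rule: eps_cases)
    case 1
    then have idx: "3 * n + 1 = Suc h" "3 * n + 2 = Suc (Suc h)" by simp_all
    show ?thesis unfolding idx lucasU_near_half 1(3) by (simp add: field_simps)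
  next
    case 2
    then have idx: "3 * n + 2 = h" "Suc (3 * n + 1) = h" by simp_all
    have low: "lucasU c (3 * n + 1) = c * ((b - a) / 2) - (a + b) / 2"
      using lucasU.simps(3)[of c "3 * n + 1"] unfolding idx lucasU_near_half by linarith
    show ?thesis unfolding low idx(1) lucasU_near_half 2(3) by (simp add: field_simps)
  qed
  then show "2 * (lucasU c (3 * n + 2) + lucasU c (3 * n + 1)) = c * b + \<epsilon> * (c + 2) * a"
    "2 * (lucasU c (3 * n + 2) - lucasU c (3 * n + 1)) = c * a + \<epsilon> * (c - 2) * b" by auto
qed

text \<open>Since 3m = \<open>p - \<epsilon>\<close>, the left sides are four times sin (2 (p -
  \<open>\<epsilon>\<close>) w) / sin (2w) and four times 2 cos (2 (p - \<open>\<epsilon>\<close>)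
  w), expanded by the addition and double-angle formulas.\<close>

lemma lucasU_high_index:
  "4 * lucasU c (3 * m) = 2 * c * (a * b) - \<epsilon> * ((c + 2) * (a * a) + (c - 2) * (b * b))"
  "4 * (2 * lucasU c (3 * m + 1) - c * lucasU c (3 * m))
    = c * ((c + 2) * (a * a)) + c * ((c - 2) * (b * b)) + 2 * \<epsilon> * (4 - c\<^sup>2) * (a * b)"
proof -
  have "4 * lucasU c (3 * m) = 2 * c * (a * b) - \<epsilon> * ((c + 2) * (a * a) + (c - 2) * (b * b)) \<and>
    4 * (2 * lucasU c (3 * m + 1) - c * lucasU c (3 * m))
    = c * ((c + 2) * (a * a)) + c * ((c - 2) * (b * b)) + 2 * \<epsilon> * (4 - c\<^sup>2) * (a * b)"
  proof (cases rule: eps_cases)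
    case 1
    then have "3 * m = 2 * h" by (simp add: m_def)
    then show ?thesis
      using lucasU_double[of c h] 1 unfolding lucasU_near_half
      by (simp only:) (simp add: field_simps power2_eq_square)
  next
    case 2
    then have "3 * m = 2 * Suc h" by (simp add: m_def)
    then show ?thesis
      using lucasU_double[of c "Suc h"] 2 unfolding lucasU_near_half
      by (simp only:) (simp add: field_simps power2_eq_square)
  qed
  then show "4 * lucasU c (3 * m) = 2 * c * (a * b) - \<epsilon> * ((c + 2) * (a * a) + (c - 2) * (b * b))"
    "4 * (2 * lucasU c (3 * m + 1) - c * lucasU c (3 * m))
    = c * ((c + 2) * (a * a)) + c * ((c - 2) * (b * b)) + 2 * \<epsilon> * (4 - c\<^sup>2) * (a * b)" by auto
qed

section \<open>The lower and upper partial sums as functions of \<open>t\<close>\<close>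

lemma D_S_low: "k \<in> {0..n} \<Longrightarrow> S k \<in> D p"
  using S_low[of k] n_less_h by auto

lemma low_sum: "32 * t * (\<Sum>k = 0..n. S k * x ^ k) \<approx> (1 + 12 * t) * L - (1 - 12 * t) * A"
proof -
  define G where "G = (\<Sum>k = 0..n. S k * x ^ k)"
  define N :: rat where "N = 2 * of_nat n + 1"
  define W where "W = lucasU (- 432 * x + 2) (Suc n) + lucasU (- 432 * x + 2) n"
  have DG [simp]: "G \<in> D p" "N \<in> D p" unfolding G_def N_def by (auto intro!: D_sum D_mult D_S_low)
  have "2 * N * G \<approx> W" unfolding G_def N_def W_def by (rule sum_S_low) simp
  \<comment> \<open>The factor c + 1 = -12t is sin (3w) / sin w and converts \<open>W\<close> to the
    parameter \<open>c\<close>; the factor \<open>- 6 * \<epsilon>\<close> makes the constant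
    \<open>2 * N\<close> into -8 modulo p, by \<open>N3\<close>.\<close>
  from congp_lmult[OF _ this, of "- 6 * \<epsilon> * (c + 1)"]
  have 1: "- 6 * \<epsilon> * (c + 1) * (2 * N * G) \<approx> - 6 * \<epsilon> * (c + 1) * W" by simp
  have N3: "3 * N = of_nat p + 2 * \<epsilon>" unfolding N_def by (cases rule: eps_cases) auto
  have cW: "2 * ((c + 1) * W) = c * b + \<epsilon> * (c + 2) * a"
    unfolding lucasU_low_index(1)[symmetric] W_def triple_arg lucasU_triple
    by (simp add: algebra_simps)
  have "3 * (32 * t * G) = - 8 * (c + 1) * G" by (simp add: c_def)
  also have "\<dots> \<approx> - 6 * \<epsilon> * (c + 1) * (2 * N * G)"
  proof (intro congpI[of _ _ "4 * \<epsilon> * (c + 1) * G"])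
    have "- 6 * \<epsilon> * (c + 1) * (2 * N * G) = - 4 * \<epsilon> * (c + 1) * (3 * N) * G" by simp
    also have "\<dots> = - of_nat p * (4 * \<epsilon> * (c + 1) * G) - 8 * (\<epsilon> * \<epsilon>) * (c + 1) * G"
      unfolding N3 by (simp add: algebra_simps)
    finally show "- 8 * (c + 1) * G - - 6 * \<epsilon> * (c + 1) * (2 * N * G) = of_nat p * (4 * \<epsilon> * (c + 1) * G)"
      unfolding eps_square by (simp add: algebra_simps)
  qed auto
  also note 1
  also have "- 6 * \<epsilon> * (c + 1) * W = - 3 * \<epsilon> * (2 * ((c + 1) * W))" by simp
  also have "\<dots> = - 3 * \<epsilon> * c * b - 3 * (\<epsilon> * \<epsilon>) * (c + 2) * a"
    unfolding cW by (simp add: algebra_simps)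
  also have "\<dots> \<approx> - 3 * \<epsilon> * c * (\<epsilon> * L) - 3 * (\<epsilon> * \<epsilon>) * (c + 2) * A"
    by (rule congp_diff; rule congp_lmult) (auto simp: a_cong b_cong)
  also have "\<dots> = - 3 * (\<epsilon> * \<epsilon>) * (c * L) - 3 * (\<epsilon> * \<epsilon>) * (c + 2) * A" by simp
  also have "\<dots> = 3 * ((1 + 12 * t) * L - (1 - 12 * t) * A)"
    unfolding eps_square by (simp add: c_def algebra_simps)
  finally show ?thesis unfolding G_def by (rule congp_cancel[rotated 2]) auto
qed

lemma low_odd_sum:
  "8 * (1 + 6 * t) * (\<Sum>k = 0..n. of_nat (2 * k + 1) * S k * x ^ k)
    \<approx> (1 + 12 * t) * A + 3 * (1 + 4 * t) * L"
proof -
  define G where "G = (\<Sum>k = 0..n. of_nat (2 * k + 1) * S k * x ^ k)"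
  define W where "W = lucasU (- 432 * x + 2) (Suc n) - lucasU (- 432 * x + 2) n"
  have "2 * G \<approx> W" unfolding G_def W_def by (rule sum_odd_S_low) simp
  \<comment> \<open>Now the conversion factor is c - 1 = -2 (1 + 6t), which is cos (3w) / cos w;
    this is the origin of the denominator 1 + 6t.\<close>
  from congp_lmult[OF _ this, of "- 2 * (c - 1)"]
  have 1: "- 2 * (c - 1) * (2 * G) \<approx> - 2 * (c - 1) * W" by simp
  have cW: "2 * ((c - 1) * W) = c * a + \<epsilon> * (c - 2) * b"
    unfolding lucasU_low_index(2)[symmetric] W_def triple_arg lucasU_triple
    by (simp add: algebra_simps)
  have "8 * (1 + 6 * t) * G = - 2 * (c - 1) * (2 * G)" by (simp add: c_def algebra_simps)
  also note 1
  also have "- 2 * (c - 1) * W = - (2 * ((c - 1) * W))" by (simp add: algebra_simps)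
  also have "\<dots> = - c * a - \<epsilon> * (c - 2) * b" unfolding cW by simp
  also have "\<dots> \<approx> - c * A - \<epsilon> * (c - 2) * (\<epsilon> * L)"
    by (rule congp_diff; rule congp_lmult) (auto simp: a_cong b_cong)
  also have "\<dots> = - c * A - (\<epsilon> * \<epsilon>) * ((c - 2) * L)" by simp
  also have "\<dots> = (1 + 12 * t) * A + 3 * (1 + 4 * t) * L"
    unfolding eps_square by (simp add: c_def algebra_simps)
  finally show ?thesis unfolding G_def .
qed

lemma high_sum:
  assumes t0: "\<not> t \<approx> 0"
  shows "16 * (x ^ h * (\<Sum>j\<le>h. S (h + j) * x ^ j))
    \<approx> - (c\<^sup>2 * L + 3 * (1 - 12 * t) * (1 + 4 * t) * A)"
proof -
  define G where "G = (\<Sum>j\<le>h. S (h + j) * x ^ j)"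
  define V where "V = 2 * lucasU (- 432 * x + 2) (Suc m) - (- 432 * x + 2) * lucasU (- 432 * x + 2) m"
  have "8 * G \<approx> - V" unfolding G_def V_def by (rule sum_S_high) simp
  from congp_lmult[OF _ this, of "4 * x ^ h"]
  have 1: "4 * x ^ h * (8 * G) \<approx> 4 * x ^ h * - V" by simp
  have V: "V = 2 * lucasU c (3 * m + 1) - c * lucasU c (3 * m)"
    unfolding V_def triple_arg lucasU_triple
    by (simp add: algebra_simps power2_eq_square power3_eq_cube)
  have "4 * V \<approx> c * (c + 2) + c * (c - 2) + 2 * \<epsilon> * (4 - c\<^sup>2) * (\<epsilon> * (A * L))"
    unfolding V lucasU_high_index
    by (rule congp_add; (rule congp_add)?; rule congp_lmult) (auto simp: a_square b_square ab_cong)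
  also have "\<dots> = c * (c + 2) + c * (c - 2) + (\<epsilon> * \<epsilon>) * (2 * (4 - c\<^sup>2) * (A * L))" by simp
  also have "\<dots> = 2 * c\<^sup>2 + 2 * (4 - c\<^sup>2) * (A * L)"
    unfolding eps_square by (simp add: algebra_simps power2_eq_square)
  finally have 2: "4 * V \<approx> 2 * c\<^sup>2 + 2 * (4 - c\<^sup>2) * (A * L)" .
  have half: "h + h = p - 1" using p_eq by simp
  \<comment> \<open>\<open>x ^ h\<close> is \<open>L\<close> times t^(p - 1), so a unit
    \<open>t\<close> leaves only \<open>L\<close>.\<close>
  have "t ^ h * t ^ h \<approx> 1" using Fermat_unit[OF t t0] unfolding half[symmetric] power_add .
  from congp_lmult[OF _ this, of L] have 3: "x ^ h \<approx> L" by (simp add: x_power_h ac_simps)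
  have "2 * (16 * (x ^ h * G)) = 4 * x ^ h * (8 * G)" by simp
  also note 1
  also have "4 * x ^ h * - V = - 1 * (x ^ h * (4 * V))" by simp
  also have "\<dots> \<approx> - 1 * (L * (2 * c\<^sup>2 + 2 * (4 - c\<^sup>2) * (A * L)))"
    by (rule congp_lmult[OF _ congp_mult[OF 3 2]]) auto
  \<comment> \<open>The factorization 4 - c^2 = 3 (1 - 12t)(1 + 4t) provides the 1 + 4t that
    \<open>L_square\<close> requires.\<close>
  also have "\<dots> = - 2 * c\<^sup>2 * L - 6 * (1 - 12 * t) * A * ((1 + 4 * t) * (L * L))"
    by (simp add: c_def algebra_simps power2_eq_square)
  also have "\<dots> \<approx> - 2 * c\<^sup>2 * L - 6 * (1 - 12 * t) * A * (1 + 4 * t)"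
    by (rule congp_diff; (rule congp_lmult)?) (auto simp: L_square)
  also have "\<dots> = 2 * - (c\<^sup>2 * L + 3 * (1 - 12 * t) * (1 + 4 * t) * A)" by (simp add: algebra_simps)
  finally show ?thesis unfolding G_def by (rule congp_cancel[rotated 2]) auto
qed

lemma high_odd_sum:
  "8 * (1 + 6 * t) * (x ^ h * (\<Sum>j\<le>h. of_nat (2 * (h + j) + 1) * S (h + j) * x ^ j))
    \<approx> 6 * (1 + 12 * t) * t * (1 + 4 * t) * (A - L)"
proof -
  define G where "G = (\<Sum>j\<le>h. of_nat (2 * (h + j) + 1) * S (h + j) * x ^ j)"
  define U where "U = lucasU (- 432 * x + 2) m"
  have DG [simp]: "G \<in> D p" "U \<in> D p"
    unfolding G_def U_def using S_high by (auto intro!: D_sum D_mult D_lucasU)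
  have "4 * G \<approx> - (of_nat m * (- 432 * x) * U)" unfolding G_def U_def by (rule sum_odd_S_high) simp
  from congp_lmult[OF _ this, of "- 12 * (c - 1) * x ^ h"]
  have 1: "- 12 * (c - 1) * x ^ h * (4 * G) \<approx> - 12 * (c - 1) * x ^ h * - (of_nat m * (- 432 * x) * U)"
    by simp
  have U: "lucasU c (3 * m) = (c\<^sup>2 - 1) * U"
    unfolding U_def triple_arg by (rule lucasU_triple)
  \<comment> \<open>One factor t of \<open>x\<close> is spent on c + 1 = -12t to complete c^2 - 1;
    the other remains available for Fermat.\<close>
  have xU: "(c - 1) * ((- 432 * x) * U) = 36 * t * (1 + 4 * t) * lucasU c (3 * m)"
    unfolding U by (simp add: c_def x_def algebra_simps power2_eq_square)
  have "4 * lucasU c (3 * m) \<approx> 2 * c * (\<epsilon> * (A * L)) - \<epsilon> * ((c + 2) + (c - 2))"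
    unfolding lucasU_high_index
    by (rule congp_diff; rule congp_lmult; (rule congp_add)?) (auto simp: a_square b_square ab_cong)
  also have "\<dots> = 2 * c * \<epsilon> * (A * L - 1)" by (simp add: algebra_simps)
  finally have 2: "4 * lucasU c (3 * m) \<approx> 2 * c * \<epsilon> * (A * L - 1)" .
  \<comment> \<open>The spare factor \<open>t\<close> makes this valid also for t divisible by p, so
    no unit assumption enters.\<close>
  have 3: "t * x ^ h \<approx> t * L"
    using congp_lmult[OF _ Fermat_h[OF t], of L] by (simp add: x_power_h ac_simps)
  have "12 * (8 * (1 + 6 * t) * (x ^ h * G)) = - 12 * (c - 1) * x ^ h * (4 * G)"
    by (simp add: c_def algebra_simps)
  also note 1
  also have "- 12 * (c - 1) * x ^ h * - (of_nat m * (- 432 * x) * U)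
      = 4 * (3 * of_nat m) * x ^ h * ((c - 1) * ((- 432 * x) * U))" by (simp add: algebra_simps)
  also have "\<dots> = (3 * of_nat m) * (36 * (1 + 4 * t)) * ((t * x ^ h) * (4 * lucasU c (3 * m)))"
    unfolding xU by (simp add: ac_simps)
  also have "\<dots> \<approx> (3 * of_nat m) * (36 * (1 + 4 * t)) * ((t * L) * (2 * c * \<epsilon> * (A * L - 1)))"
    by (rule congp_lmult[OF _ congp_mult[OF 3 2]]) auto
  \<comment> \<open>By \<open>m_eq\<close>, the factor 3m is \<open>- \<epsilon>\<close> modulo
    p.\<close>
  also have "\<dots> \<approx> - \<epsilon> * (36 * (1 + 4 * t)) * ((t * L) * (2 * c * \<epsilon> * (A * L - 1)))"
    by (intro congpI[of _ _ "(36 * (1 + 4 * t)) * ((t * L) * (2 * c * \<epsilon> * (A * L - 1)))"])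
      (auto simp: m_eq left_diff_distrib)
  also have "\<dots> = - 72 * (\<epsilon> * \<epsilon>) * (c * t * (1 + 4 * t) * L * (A * L - 1))"
    by (simp add: algebra_simps)
  also have "\<dots> = - 72 * c * t * A * ((1 + 4 * t) * (L * L)) - - 72 * c * t * (1 + 4 * t) * L"
    unfolding eps_square by (simp add: algebra_simps)
  also have "\<dots> \<approx> - 72 * c * t * A * (1 + 4 * t) - - 72 * c * t * (1 + 4 * t) * L"
    by (rule congp_diff; (rule congp_lmult)?) (auto simp: L_square)
  also have "\<dots> = 12 * (6 * (1 + 12 * t) * t * (1 + 4 * t) * (A - L))"
    by (simp add: c_def algebra_simps)
  finally have "12 * (8 * (1 + 6 * t) * (x ^ h * G)) \<approx> 12 * (6 * (1 + 12 * t) * t * (1 + 4 * t) * (A - L))" .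
  moreover have "\<not> 12 \<approx> 0" using unit_mult[of "2 ^ 2" 3] unit_2_power[of 2] by simp
  ultimately show ?thesis unfolding G_def using congp_cancel[OF D_numeral(1)] by blast
qed

end

section \<open>Assembly of the four congruences\<close>

theorem theorem36:
  fixes p :: nat and t :: rat
  assumes "prime p" and "p > 3" and "t \<in> D p"
  shows
    "(\<not> rat_cong t 0 p \<longrightarrow>
        rat_cong (\<Sum>k = 0..p div 6. S k * (t^2 * (4 * t + 1)) ^ k)
          ((1 + 12 * t) / (32 * t) * rat_Legendre (1 + 4 * t) p
            - (1 - 12 * t) / (32 * t) * rat_Legendre (1 - 12 * t) p) p \<and>
        rat_cong (\<Sum>k = 0..p - 1. S k * (t^2 * (4 * t + 1)) ^ k)
          ((1 + 12 * t) * (1 + 4 * t) * (1 - 6 * t) / (32 * t) * rat_Legendre (1 + 4 * t) p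
            - (1 - 12 * t) * (24 * t^2 + 6 * t + 1) / (32 * t) * rat_Legendre (1 - 12 * t) p) p) \<and>
     (\<not> rat_cong (6 * t + 1) 0 p \<longrightarrow>
        rat_cong (\<Sum>k = 0..p div 6. of_nat (2 * k + 1) * S k * (t^2 * (4 * t + 1)) ^ k)
          ((1 + 12 * t) / (8 * (1 + 6 * t)) * rat_Legendre (1 - 12 * t) p
            + 3 * (1 + 4 * t) / (8 * (1 + 6 * t)) * rat_Legendre (1 + 4 * t) p) p \<and>
        rat_cong (\<Sum>k = 0..p - 1. of_nat (2 * k + 1) * S k * (t^2 * (4 * t + 1)) ^ k)
          ((1 + 12 * t) * (24 * t^2 + 6 * t + 1) / (8 * (1 + 6 * t)) * rat_Legendre (1 - 12 * t) p
            + 3 * (1 - 6 * t) * (1 + 4 * t)^2 / (8 * (1 + 6 * t)) * rat_Legendre (1 + 4 * t) p) p)"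
proof -
  interpret prime_localization_point p t using assms by unfold_locales
  define lL lA where "lL = rat_Legendre (1 + 4 * t) p" and "lA = rat_Legendre (1 - 12 * t) p"
  have lL: "L \<approx> lL" and lA: "A \<approx> lA" unfolding L_def A_def lL_def lA_def
    by (rule congp_sym, rule rat_Legendre_cong, simp)+
  define G1 H1 G2 H2 where "G1 = (\<Sum>k = 0..n. S k * x ^ k)"
    and "H1 = x ^ h * (\<Sum>j\<le>h. S (h + j) * x ^ j)"
    and "G2 = (\<Sum>k = 0..n. of_nat (2 * k + 1) * S k * x ^ k)"
    and "H2 = x ^ h * (\<Sum>j\<le>h. of_nat (2 * (h + j) + 1) * S (h + j) * x ^ j)"
  have full1: "(\<Sum>k = 0..p - 1. S k * x ^ k) \<approx> G1 + H1"
    unfolding G1_def H1_def using sum_split_S[of x "\<lambda>_. 1"] by simp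
  have full2: "(\<Sum>k = 0..p - 1. of_nat (2 * k + 1) * S k * x ^ k) \<approx> G2 + H2"
    unfolding G2_def H2_def by (rule sum_split_S) auto
  \<comment> \<open>Each claim is proved after multiplication by its denominator, 32t here and 8 (1
    + 6t) later, and the denominator, a unit under the respective hypothesis, is then
    cancelled.\<close>
  have main1: "G1 \<approx> (1 + 12 * t) / (32 * t) * lL - (1 - 12 * t) / (32 * t) * lA"
    (is "_ \<approx> ?R1")
    and main2: "G1 + H1 \<approx> (1 + 12 * t) * (1 + 4 * t) * (1 - 6 * t) / (32 * t) * lL
      - (1 - 12 * t) * (24 * t\<^sup>2 + 6 * t + 1) / (32 * t) * lA" (is "_ \<approx> ?R2")
    if t0: "\<not> t \<approx> 0"
  proof -
    have nz: "t \<noteq> 0" using t0 by auto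
    have u: "\<not> 32 * t \<approx> 0" using unit_mult[OF _ _ t0, of 32] unit_2_power[of 5] by simp
    have G1: "32 * t * G1 \<approx> (1 + 12 * t) * L - (1 - 12 * t) * A"
      unfolding G1_def by (rule low_sum)
    also have "\<dots> \<approx> (1 + 12 * t) * lL - (1 - 12 * t) * lA"
      by (rule congp_diff; rule congp_lmult) (auto simp: lL lA)
    also have "\<dots> = 32 * t * ?R1" using nz by (simp add: field_simps)
    finally show "G1 \<approx> ?R1" by (rule congp_cancel[rotated 2]) (auto simp: u)
    have H1: "16 * H1 \<approx> - (c\<^sup>2 * L + 3 * (1 - 12 * t) * (1 + 4 * t) * A)"
      unfolding H1_def by (rule high_sum[OF t0])
    have "32 * t * (G1 + H1) = 32 * t * G1 + 2 * t * (16 * H1)" by (simp add: algebra_simps)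
    also have "\<dots> \<approx> ((1 + 12 * t) * L - (1 - 12 * t) * A)
        + 2 * t * - (c\<^sup>2 * L + 3 * (1 - 12 * t) * (1 + 4 * t) * A)"
      by (rule congp_add[OF G1 congp_lmult[OF _ H1]]) auto
    \<comment> \<open>With c^2 = (1 + 12t)^2, the factor of \<open>L\<close> comes from 1 - 2t (1 +
      12t) = (1 + 4t)(1 - 6t), and that of \<open>A\<close> from 1 + 6t (1 + 4t).\<close>
    also have "\<dots> = (1 + 12 * t) * (1 + 4 * t) * (1 - 6 * t) * L
        - (1 - 12 * t) * (24 * t\<^sup>2 + 6 * t + 1) * A"
      by (simp add: c_def algebra_simps power2_eq_square)
    also have "\<dots> \<approx> (1 + 12 * t) * (1 + 4 * t) * (1 - 6 * t) * lL
        - (1 - 12 * t) * (24 * t\<^sup>2 + 6 * t + 1) * lA"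
      by (rule congp_diff; rule congp_lmult) (auto simp: lL lA)
    also have "\<dots> = 32 * t * ?R2" using nz by (simp add: right_diff_distrib)
    finally show "G1 + H1 \<approx> ?R2" by (rule congp_cancel[rotated 2]) (auto simp: u)
  qed
  have main3: "G2 \<approx> (1 + 12 * t) / (8 * (1 + 6 * t)) * lA + 3 * (1 + 4 * t) / (8 * (1 + 6 * t)) * lL"
    (is "_ \<approx> ?R3")
    and main4: "G2 + H2 \<approx> (1 + 12 * t) * (24 * t\<^sup>2 + 6 * t + 1) / (8 * (1 + 6 * t)) * lA
      + 3 * (1 - 6 * t) * (1 + 4 * t)\<^sup>2 / (8 * (1 + 6 * t)) * lL" (is "_ \<approx> ?R4")
    if t1: "\<not> 6 * t + 1 \<approx> 0"
  proof -
    define d where "d = 8 * (1 + 6 * t)"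
    have u: "\<not> d \<approx> 0" unfolding d_def
      using unit_mult[OF _ _ t1, of 8] unit_2_power[of 3] by (simp add: add.commute)
    then have nz: "d \<noteq> 0" by auto
    have Dd: "d \<in> D p" unfolding d_def by simp
    have G2: "d * G2 \<approx> (1 + 12 * t) * A + 3 * (1 + 4 * t) * L"
      unfolding G2_def d_def by (rule low_odd_sum)
    also have "\<dots> \<approx> (1 + 12 * t) * lA + 3 * (1 + 4 * t) * lL"
      by (rule congp_add; rule congp_lmult) (auto simp: lL lA)
    also have "\<dots> = d * ?R3" unfolding d_def[symmetric] using nz by (simp add: distrib_left)
    finally show "G2 \<approx> ?R3" by (rule congp_cancel[OF Dd u])
    have H2: "d * H2 \<approx> 6 * (1 + 12 * t) * t * (1 + 4 * t) * (A - L)"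
      unfolding H2_def d_def by (rule high_odd_sum)
    have "d * (G2 + H2) = d * G2 + d * H2" by (rule distrib_left)
    also have "\<dots> \<approx> ((1 + 12 * t) * A + 3 * (1 + 4 * t) * L)
        + 6 * (1 + 12 * t) * t * (1 + 4 * t) * (A - L)"
      by (rule congp_add[OF G2 H2])
    also have "\<dots> = (1 + 12 * t) * (24 * t\<^sup>2 + 6 * t + 1) * A + 3 * (1 - 6 * t) * (1 + 4 * t)\<^sup>2 * L"
      by (simp add: algebra_simps power2_eq_square)
    also have "\<dots> \<approx> (1 + 12 * t) * (24 * t\<^sup>2 + 6 * t + 1) * lA + 3 * (1 - 6 * t) * (1 + 4 * t)\<^sup>2 * lL"
      by (rule congp_add; rule congp_lmult) (auto simp: lL lA)
    also have "\<dots> = d * ?R4" unfolding d_def[symmetric] using nz by (simp add: distrib_left)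
    finally show "G2 + H2 \<approx> ?R4" by (rule congp_cancel[OF Dd u])
  qed
  show ?thesis
    unfolding x_def[symmetric] n_def[symmetric] lL_def[symmetric] lA_def[symmetric]
      G1_def[symmetric] G2_def[symmetric] congp_def[symmetric]
    using main1 main2 main3 main4 congp_trans[OF full1] congp_trans[OF full2] by blast
qed

end
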